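(* Let $0<\sigma<p<\infty$ and $\beta=1/\sigma-1/p$. Then for all $0<\alpha<\beta$ and $0<q\le\infty$, $$\mathcal A_q^\alpha(L^p(S),\mathcal C)=(L^p(S),V_{\sigma,p}(S))_{\alpha/\beta,q}$$ (equality of spaces with equivalent quasi-norms).
   Context: Setting. $(\Omega,\mathscr F,|\cdot|)$ is a probability space, $\nu\ge 2$ an integer, and $(\mathscr F_n)_{n\ge 0}$ a $\nu$-ary filtration: an increasing sequence of finite sub-$\sigma$-algebras of $\mathscr F$ with $\mathscr F_0=\{\emptyset,\Omega\}$, such that for each $n\ge1$ each atom of $\mathscr F_{n-1}$ is a union of at most $\nu$ atoms of $\mathscr F_n$; all atoms have positive measure. $\mathscr A_n$ is the set of atoms of $\mathscr F_n$ and $\mathscr A=\bigcup_n\mathscr A_n$. Elements of $\mathscr A$ are called atoms; nonempty differences $A\setminus B$ with $A,B\in\mathscr A$, $B\subsetneq A$, are called rings. $S$ is a finite-dimensional linear space of bounded $\mathscr F$-measurable scalar-valued functions on $\Omega$ for which there are constants $c_1,c_2\in(0,1]$ with $|\{\omega\in A:|f(\omega)|\ge c_1\|f\|_A\}|\ge c_2|A|$ for all $A\in\mathscr A$, $f\in S$, where $\|f\|_A$ is the $L^\infty$-norm of $f$ on $A$. For $R\in\mathscr F$, $S_R=\{f\mathbf 1_R:f\in S\}$. Dictionary: $\mathcal C=\{f\mathbf 1_A:f\in S,A\in\mathscr A\}$, and $L^p(S)$ is the closure of $\operatorname{span}\mathcal C$ in $L^p(\Omega)$. Variation space: $E_p(f,R)=\inf\{\|f-g\|_{L^p(R)}:g\in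 S_R\}$, $|f|_{V_{\sigma,p}}=\sup_\Pi\big(\sum_{R\in\Pi}E_p(f,R)^\sigma\big)^{1/\sigma}$, the supremum being over all finite collections $\Pi$ of pairwise disjoint atoms or rings; $V_{\sigma,p}(S)=\{f\in L^p(S):\|f\|_{V_{\sigma,p}}:=\|f\|_p+|f|_{V_{\sigma,p}}<\infty\}$. Approximation space: for a quasi-normed space $\mathcal X$ and linearly dense $\mathcal D\subset\mathcal X$, $\Sigma_n^{\mathcal D}$ is the set of linear combinations of $n$ elements of $\mathcal D$, $\sigma_n(x,\mathcal D)=\inf\{\|x-y\|:y\in\Sigma_n^{\mathcal D}\}$, and $\mathcal A_q^\alpha(\mathcal X,\mathcal D)=\{x\in\mathcal X:\|x\|+\|(2^{n\alpha}\sigma_{2^n}(x,\mathcal D))_{n\ge0}\|_{\ell^q}<\infty\}$ with the displayed expression as quasi-norm. Interpolation: for $\mathcal Y$ continuously embedded in $\mathcal X$, $K(f,t)=\inf\{\|f-g\|_{\mathcal X}+t\|g\|_{\mathcal Y}:g\in\mathcal Y\}$, and $(\mathcal X,\mathcal Y)_{\theta,q}$ is the real interpolation space, with quasi-norm equivalent to $\|(2^{n\theta}K(f,2^{-n}))_{n\ge0}\|_{\ell^q}$. *)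

theory Defs
  imports "HOL-Probability.Probability" "HOL-Library.Function_Algebras"
begin

text \<open>
  The scalars are an arbitrary type of sort \<open>{real_normed_field, euclidean_space}\<close>, which covers
  the real and the complex case simultaneously. Elements of function spaces are actual functions,
  not classes modulo a.e. equality; all norms below are a.e. invariant. Norms take values in
  \<open>ennreal\<close>, and a space consists of the functions whose norm is finite.
\<close>

definition fscale :: "'k::field \<Rightarrow> ('a \<Rightarrow> 'k) \<Rightarrow> 'a \<Rightarrow> 'k" where
  "fscale c f = (\<lambda>\<omega>. c * f \<omega>)"

global_interpretation scalar_fun: vector_space "fscale :: 'k::field \<Rightarrow> ('a \<Rightarrow> 'k) \<Rightarrow> 'a \<Rightarrow> 'k"
  by unfold_locales (auto simp: fscale_def fun_eq_iff algebra_simps)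

definition cut :: "('a \<Rightarrow> 'k::field) \<Rightarrow> 'a set \<Rightarrow> 'a \<Rightarrow> 'k" where
  "cut f R = (\<lambda>\<omega>. f \<omega> * indicator R \<omega>)"

text \<open>Powers in \<open>ennreal\<close>; only used with exponent \<open>r > 0\<close>.\<close>

definition ennpowr :: "ennreal \<Rightarrow> real \<Rightarrow> ennreal" where
  "ennpowr x r = (if x = top then top else ennreal (enn2real x powr r))"


section \<open>Filtrations, atoms and rings\<close>

definition atoms_of :: "'a set set \<Rightarrow> 'a set set" where
  "atoms_of \<A> = {A \<in> \<A>. A \<noteq> {} \<and> (\<forall>B\<in>\<A>. B \<subseteq> A \<longrightarrow> B = {} \<or> B = A)}"

definition nary_filtration :: "'a measure \<Rightarrow> nat \<Rightarrow> (nat \<Rightarrow> 'a set set) \<Rightarrow> bool" where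
  "nary_filtration M \<nu> F \<longleftrightarrow>
     (\<forall>n. sigma_algebra (space M) (F n) \<and> finite (F n) \<and> F n \<subseteq> sets M) \<and>
     mono F \<and>
     F 0 = {{}, space M} \<and>
     (\<forall>n\<ge>1. \<forall>A\<in>atoms_of (F (n - 1)). \<exists>\<B>\<subseteq>atoms_of (F n). card \<B> \<le> \<nu> \<and> A = \<Union>\<B>) \<and>
     (\<forall>n. \<forall>A\<in>atoms_of (F n). measure M A > 0)"

definition atoms :: "(nat \<Rightarrow> 'a set set) \<Rightarrow> 'a set set" where
  "atoms F = (\<Union>n. atoms_of (F n))"

definition rings :: "(nat \<Rightarrow> 'a set set) \<Rightarrow> 'a set set" where
  "rings F = {A - B | A B. A \<in> atoms F \<and> B \<in> atoms F \<and> B \<subset> A}"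


section \<open>The space \<open>S\<close>, the dictionary and \<open>L\<^sup>p(S)\<close>\<close>

definition Linf_norm_on :: "'a measure \<Rightarrow> 'a set \<Rightarrow> ('a \<Rightarrow> 'k::real_normed_vector) \<Rightarrow> ennreal" where
  "Linf_norm_on M A f = esssup (restrict_space M A) (\<lambda>\<omega>. ennreal (norm (f \<omega>)))"

definition admissible_space ::
  "'a measure \<Rightarrow> (nat \<Rightarrow> 'a set set) \<Rightarrow> ('a \<Rightarrow> 'k::{real_normed_field,euclidean_space}) set \<Rightarrow> bool" where
  "admissible_space M F S \<longleftrightarrow>
     (\<exists>B. finite B \<and> S = scalar_fun.span B) \<and>
     (\<forall>f\<in>S. f \<in> borel_measurable M \<and> (\<exists>b. \<forall>\<omega>\<in>space M. norm (f \<omega>) \<le> b)) \<and>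
     (\<exists>c1 c2 :: real. 0 < c1 \<and> c1 \<le> 1 \<and> 0 < c2 \<and> c2 \<le> 1 \<and>
        (\<forall>A\<in>atoms F. \<forall>f\<in>S.
           measure M {\<omega>\<in>A. ennreal (norm (f \<omega>)) \<ge> ennreal c1 * Linf_norm_on M A f}
             \<ge> c2 * measure M A))"

definition Lp_norm_on :: "'a measure \<Rightarrow> real \<Rightarrow> 'a set \<Rightarrow> ('a \<Rightarrow> 'k::real_normed_vector) \<Rightarrow> ennreal" where
  "Lp_norm_on M p R f = ennpowr (\<integral>\<^sup>+\<omega>\<in>R. ennreal (norm (f \<omega>) powr p) \<partial>M) (1 / p)"

abbreviation Lp_norm :: "'a measure \<Rightarrow> real \<Rightarrow> ('a \<Rightarrow> 'k::real_normed_vector) \<Rightarrow> ennreal" where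
  "Lp_norm M p \<equiv> Lp_norm_on M p (space M)"

definition Lp_space :: "'a measure \<Rightarrow> real \<Rightarrow> ('a \<Rightarrow> 'k::real_normed_vector) set" where
  "Lp_space M p = {f \<in> borel_measurable M. Lp_norm M p f < \<infinity>}"

definition dict :: "(nat \<Rightarrow> 'a set set) \<Rightarrow> ('a \<Rightarrow> 'k::field) set \<Rightarrow> ('a \<Rightarrow> 'k) set" where
  "dict F S = {cut f A | f A. f \<in> S \<and> A \<in> atoms F}"

definition LpS :: "'a measure \<Rightarrow> (nat \<Rightarrow> 'a set set) \<Rightarrow> ('a \<Rightarrow> 'k::{real_normed_field,euclidean_space}) set \<Rightarrow>
    real \<Rightarrow> ('a \<Rightarrow> 'k) set" where
  "LpS M F S p =
     {f \<in> Lp_space M p. \<forall>\<epsilon>>0. \<exists>g\<in>scalar_fun.span (dict F S). Lp_norm M p (f - g) < ennreal \<epsilon>}"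


section \<open>The variation space\<close>

definition local_error :: "'a measure \<Rightarrow> ('a \<Rightarrow> 'k::{real_normed_field,euclidean_space}) set \<Rightarrow> real \<Rightarrow>
    ('a \<Rightarrow> 'k) \<Rightarrow> 'a set \<Rightarrow> ennreal" where
  "local_error M S p f R = (INF g\<in>{cut h R | h. h \<in> S}. Lp_norm_on M p R (f - g))"

definition variation :: "'a measure \<Rightarrow> (nat \<Rightarrow> 'a set set) \<Rightarrow> ('a \<Rightarrow> 'k::{real_normed_field,euclidean_space}) set \<Rightarrow>
    real \<Rightarrow> real \<Rightarrow> ('a \<Rightarrow> 'k) \<Rightarrow> ennreal" where
  "variation M F S \<sigma> p f =
     (SUP \<R>\<in>{\<R>. finite \<R> \<and> \<R> \<subseteq> atoms F \<union> rings F \<and> disjoint \<R>}.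
        ennpowr (\<Sum>R\<in>\<R>. ennpowr (local_error M S p f R) \<sigma>) (1 / \<sigma>))"

definition V_norm :: "'a measure \<Rightarrow> (nat \<Rightarrow> 'a set set) \<Rightarrow> ('a \<Rightarrow> 'k::{real_normed_field,euclidean_space}) set \<Rightarrow>
    real \<Rightarrow> real \<Rightarrow> ('a \<Rightarrow> 'k) \<Rightarrow> ennreal" where
  "V_norm M F S \<sigma> p f = Lp_norm M p f + variation M F S \<sigma> p f"

definition V_space :: "'a measure \<Rightarrow> (nat \<Rightarrow> 'a set set) \<Rightarrow> ('a \<Rightarrow> 'k::{real_normed_field,euclidean_space}) set \<Rightarrow>
    real \<Rightarrow> real \<Rightarrow> ('a \<Rightarrow> 'k) set" where
  "V_space M F S \<sigma> p = {f \<in> LpS M F S p. V_norm M F S \<sigma> p f < \<infinity>}"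


section \<open>Approximation spaces\<close>

text \<open>In this and the next section a quasi-normed space is given by its carrier \<open>X\<close> and its
  quasi-norm \<open>N\<close>. The exponent \<open>q \<in> (0, \<infinity>]\<close> is an \<open>ennreal\<close>.\<close>

definition lq_norm :: "ennreal \<Rightarrow> (nat \<Rightarrow> ennreal) \<Rightarrow> ennreal" where
  "lq_norm q a =
     (if q = \<infinity> then (SUP n. a n)
      else ennpowr (\<Sum>n. ennpowr (a n) (enn2real q)) (1 / enn2real q))"

definition n_term :: "nat \<Rightarrow> ('a \<Rightarrow> 'k::field) set \<Rightarrow> ('a \<Rightarrow> 'k) set" where
  "n_term n D = {\<Sum>i<n. fscale (c i) (d i) | c d. \<forall>i<n. d i \<in> D}"

definition n_term_error :: "(('a \<Rightarrow> 'k::field) \<Rightarrow> ennreal) \<Rightarrow> ('a \<Rightarrow> 'k) set \<Rightarrow> nat \<Rightarrow> ('a \<Rightarrow> 'k) \<Rightarrow> ennreal" where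
  "n_term_error N D n x = (INF y\<in>n_term n D. N (x - y))"

definition approx_norm :: "(('a \<Rightarrow> 'k::field) \<Rightarrow> ennreal) \<Rightarrow> ('a \<Rightarrow> 'k) set \<Rightarrow> real \<Rightarrow> ennreal \<Rightarrow>
    ('a \<Rightarrow> 'k) \<Rightarrow> ennreal" where
  "approx_norm N D \<alpha> q x =
     N x + lq_norm q (\<lambda>n. ennreal (2 powr (real n * \<alpha>)) * n_term_error N D (2 ^ n) x)"

definition approx_space :: "('a \<Rightarrow> 'k::field) set \<Rightarrow> (('a \<Rightarrow> 'k) \<Rightarrow> ennreal) \<Rightarrow> ('a \<Rightarrow> 'k) set \<Rightarrow> real \<Rightarrow>
    ennreal \<Rightarrow> ('a \<Rightarrow> 'k) set" where
  "approx_space X N D \<alpha> q = {x \<in> X. approx_norm N D \<alpha> q x < \<infinity>}"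


section \<open>Real interpolation for a subspace \<open>Y\<close> of \<open>X\<close>\<close>

definition K_functional :: "('v::ab_group_add \<Rightarrow> ennreal) \<Rightarrow> 'v set \<Rightarrow> ('v \<Rightarrow> ennreal) \<Rightarrow> 'v \<Rightarrow> real \<Rightarrow> ennreal" where
  "K_functional NX Y NY f t = (INF g\<in>Y. NX (f - g) + ennreal t * NY g)"

definition interp_norm :: "('v::ab_group_add \<Rightarrow> ennreal) \<Rightarrow> 'v set \<Rightarrow> ('v \<Rightarrow> ennreal) \<Rightarrow> real \<Rightarrow> ennreal \<Rightarrow>
    'v \<Rightarrow> ennreal" where
  "interp_norm NX Y NY \<theta> q f =
     (if q = \<infinity> then (SUP t\<in>{0<..}. ennreal (t powr (- \<theta>)) * K_functional NX Y NY f t)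
      else ennpowr
        (\<integral>\<^sup>+t\<in>{0<..}. ennpowr (ennreal (t powr (- \<theta>)) * K_functional NX Y NY f t) (enn2real q)
           * ennreal (1 / t) \<partial>lborel)
        (1 / enn2real q))"

definition interp_space :: "'v::ab_group_add set \<Rightarrow> ('v \<Rightarrow> ennreal) \<Rightarrow> 'v set \<Rightarrow> ('v \<Rightarrow> ennreal) \<Rightarrow> real \<Rightarrow>
    ennreal \<Rightarrow> 'v set" where
  "interp_space X NX Y NY \<theta> q = {f \<in> X. interp_norm NX Y NY \<theta> q f < \<infinity>}"

definition equivalent_on :: "'v set \<Rightarrow> ('v \<Rightarrow> ennreal) \<Rightarrow> ('v \<Rightarrow> ennreal) \<Rightarrow> bool" where
  "equivalent_on Z N1 N2 \<longleftrightarrow>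
     (\<exists>a b :: real. 0 < a \<and> 0 < b \<and> (\<forall>x\<in>Z. ennreal a * N1 x \<le> N2 x \<and> N2 x \<le> ennreal b * N1 x))"

end

theory Submission
  imports Defs
begin

text \<open>
  Two inequalities link the dictionary to the variation space, where \<open>\<beta> = 1/\<sigma> - 1/p\<close>: the Jackson inequality
  \<open>\<sigma>\<^sub>n(g) \<lesssim> n\<^bsup>-\<beta>\<^esup> \<parallel>g\<parallel>\<^sub>V\<close> for \<open>g\<close> of finite variation, and the Bernstein inequality
  \<open>\<parallel>g\<parallel>\<^sub>V \<lesssim> n\<^bsup>\<beta>\<^esup> \<parallel>g\<parallel>\<^sub>p\<close> for combinations \<open>g\<close> of \<open>n\<close> dictionary elements. By a general
  principle of approximation theory such a pair identifies the approximation spaces with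
  the real interpolation spaces.

  The Bernstein inequality (\<open>bernstein_variation\<close>) is combinatorial. On an atom or a ring, a
  combination of \<open>n\<close> dictionary elements belongs to \<open>S\<close> unless it is split by one of the \<open>n\<close> supports, and
  since atoms are nested or disjoint, each support splits at most one set of a disjoint collection
  (\<open>splits_at_most_one\<close>). So at most \<open>n\<close> local errors are nonzero, and the power mean inequality gives
  the factor \<open>n\<^bsup>\<beta>\<^esup>\<close>.

  The Jackson inequality (\<open>jackson_threshold\<close>) cuts \<open>\<Omega>\<close> into atoms and rings on which \<open>g\<close> is
  within \<open>\<epsilon>\<close> of \<open>S\<close>. An atom is bad if this fails on it; the bad atoms form a finite tree, because \<open>g\<close> is a limit
  of functions that belong to \<open>S\<close> locally on fine levels (\<open>span_dict_locally_in_S\<close>).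
  Along a chain of bad atoms without branching one cuts off rings greedily; a cut is made only
  when a longer ring would be bad. Cuts and leaves thus produce disjoint bad sets, and
  branchings are fewer than leaves. Hence the number of pieces is at most a constant times the number of
  members of a disjoint bad family (\<open>resolved_step\<close>), which is at most \<open>(\<parallel>g\<parallel>\<^sub>V / \<epsilon>)\<^bsup>\<sigma>\<^esup>\<close>.

  For the general principle (\<open>approx_space_eq_interp_space\<close>) one compares the errors with the
  \<open>K\<close>-functional at \<open>2\<^bsup>-n\<beta>\<^esup>\<close>. The Jackson inequality bounds the error by the \<open>K\<close>-functional. For
  the converse, an approximant serves as competitor, and its \<open>V\<close>-norm is estimated by telescoping over coarser
  levels with the Bernstein inequality. The quasi-triangle inequality costs a constant factor per level;
  since \<open>\<alpha> < \<beta>\<close>, this is compensated by using only every \<open>L\<close>-th dyadic level for a large \<open>L\<close>. A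
  discrete Hardy inequality (\<open>lq_norm_contractive_recursion\<close>) concludes. Only quasi-triangle
  inequalities are used, so all exponents \<open>p\<close>, \<open>\<sigma>\<close>, \<open>q\<close>, below and above \<open>1\<close>, are treated alike.
\<close>

section \<open>Powers of extended nonnegative reals\<close>

lemma ennpowr_ennreal: "x \<ge> 0 \<Longrightarrow> ennpowr (ennreal x) r = ennreal (x powr r)"
  by (simp add: ennpowr_def)

lemma ennpowr_top [simp]: "ennpowr top r = top"
  by (simp add: ennpowr_def)

lemma ennpowr_zero [simp]: "ennpowr 0 r = 0"
  by (simp add: ennpowr_def)

lemma ennpowr_one [simp]: "ennpowr x 1 = x"
  by (cases x) (auto simp: ennpowr_def)

lemma ennpowr_eq_top_iff [simp]: "ennpowr x r = top \<longleftrightarrow> x = top"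
  by (simp add: ennpowr_def)

lemma ennpowr_mono:
  assumes "r > 0" "x \<le> y" shows "ennpowr x r \<le> ennpowr y r"
  using assms
  by (cases x; cases y) (auto simp: ennpowr_ennreal top_unique intro!: ennreal_leI powr_mono2)

lemma ennpowr_mult:
  assumes "r > 0" shows "ennpowr (x * y) r = ennpowr x r * ennpowr y r"
proof (cases x; cases y)
  fix a b :: real assume "x = ennreal a" "0 \<le> a" "y = ennreal b" "0 \<le> b"
  then show ?thesis
    by (simp add: ennreal_mult'[symmetric] ennpowr_ennreal powr_mult)
next
  fix a :: real assume "x = ennreal a" "0 \<le> a" "y = top"
  then show ?thesis
    by (cases "a = 0") (auto simp: ennpowr_ennreal ennreal_mult_top)
next
  fix a :: real assume "y = ennreal a" "0 \<le> a" "x = top"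
  then show ?thesis
    by (cases "a = 0") (auto simp: ennpowr_ennreal ennreal_top_mult)
qed auto

lemma ennpowr_ennpowr: "ennpowr (ennpowr x r) s = ennpowr x (r * s)"
  by (cases x) (auto simp: ennpowr_ennreal powr_powr)

lemma ennpowr_inverse_cancel [simp]:
  "r > 0 \<Longrightarrow> ennpowr (ennpowr x (1 / r)) r = x"
  "r > 0 \<Longrightarrow> ennpowr (ennpowr x r) (1 / r) = x"
  by (simp_all add: ennpowr_ennpowr)

lemma ennpowr_root_le_iff:
  assumes "r > 0" shows "ennpowr x (1 / r) \<le> y \<longleftrightarrow> x \<le> ennpowr y r"
  using ennpowr_mono[of r "ennpowr x (1 / r)" y] ennpowr_mono[of "1 / r" x "ennpowr y r"] assms
  by auto

lemma ennpowr_add_le: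
  assumes "r > 0"
  shows "ennpowr (x + y) r \<le> ennreal (2 powr r) * (ennpowr x r + ennpowr y r)"
proof -
  have "ennpowr (x + y) r \<le> ennpowr (ennreal 2 * max x y) r"
    by (intro ennpowr_mono assms) (simp add: mult_2 add_mono)
  also have "\<dots> = ennreal (2 powr r) * ennpowr (max x y) r"
    using assms by (subst ennpowr_mult) (auto simp: ennpowr_ennreal simp del: ennreal_numeral)
  also have "\<dots> \<le> ennreal (2 powr r) * (ennpowr x r + ennpowr y r)"
    by (intro mult_left_mono) (auto simp: max_def)
  finally show ?thesis .
qed

section \<open>Sequence quasi-norms\<close>

lemma lq_norm_infinity: "lq_norm top a = (SUP n. a n)"
  by (simp add: lq_norm_def)

lemma lq_norm_finite: "q > 0 \<Longrightarrow> lq_norm (ennreal q) a = ennpowr (\<Sum>n. ennpowr (a n) q) (1 / q)"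
  by (simp add: lq_norm_def)

lemma exponent_cases [consumes 1, case_names infinite finite]:
  fixes q :: ennreal
  assumes "0 < q"
  obtains "q = top" | r where "0 < r" "q = ennreal r"
  using assms by (cases q) (auto simp: less_le)

lemma lq_norm_mono:
  assumes "0 < q" "\<And>n. a n \<le> b n" shows "lq_norm q a \<le> lq_norm q b"
  using assms(1)
proof (cases rule: exponent_cases)
  case infinite
  then show ?thesis
    using assms(2) by (auto simp: lq_norm_infinity intro!: SUP_mono)
next
  case (finite r)
  then show ?thesis
    using assms(2) by (auto simp: lq_norm_finite intro!: ennpowr_mono suminf_le)
qed

lemma lq_norm_cmult:
  assumes "0 < q" shows "lq_norm q (\<lambda>n. c * a n) = c * lq_norm q a"
  using assms
proof (cases rule: exponent_cases)
  case infinite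
  then show ?thesis
    by (auto simp: lq_norm_infinity SUP_mult_left_ennreal)
next
  case (finite r)
  then show ?thesis
    by (simp add: lq_norm_finite ennpowr_mult ennreal_suminf_cmult)
qed

lemma lq_norm_ge_nth:
  assumes "0 < q" shows "a n \<le> lq_norm q a"
  using assms
proof (cases rule: exponent_cases)
  case infinite
  then show ?thesis
    by (auto simp: lq_norm_infinity intro: SUP_upper)
next
  case (finite r)
  have "ennpowr (ennpowr (a n) r) (1 / r) \<le> ennpowr (\<Sum>n. ennpowr (a n) r) (1 / r)"
    using finite sum_le_suminf[of "\<lambda>n. ennpowr (a n) r" "{n}"] by (intro ennpowr_mono) auto
  then show ?thesis
    using finite by (simp add: lq_norm_finite)
qed

lemma lq_norm_subsequence:
  assumes "0 < q" "strict_mono \<phi>" shows "lq_norm q (\<lambda>n. a (\<phi> n)) \<le> lq_norm q a"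
  using assms(1)
proof (cases rule: exponent_cases)
  case infinite
  then show ?thesis
    by (auto simp: lq_norm_infinity intro!: SUP_mono)
next
  case (finite r)
  have "(\<Sum>n<N. ennpowr (a (\<phi> n)) r) \<le> (\<Sum>n. ennpowr (a n) r)" for N
  proof -
    have "(\<Sum>n<N. ennpowr (a (\<phi> n)) r) = (\<Sum>n\<in>\<phi> ` {..<N}. ennpowr (a n) r)"
      using strict_mono_imp_inj_on[OF assms(2)] by (simp add: sum.reindex)
    then show ?thesis
      by (simp add: sum_le_suminf)
  qed
  then have "(\<Sum>n. ennpowr (a (\<phi> n)) r) \<le> (\<Sum>n. ennpowr (a n) r)"
    by (intro suminf_le_const) auto
  then show ?thesis
    using finite by (simp add: lq_norm_finite ennpowr_mono)
qed

lemma lq_norm_add_le: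
  assumes "0 < q"
  obtains C :: real where "0 < C" "\<And>a b. lq_norm q (\<lambda>n. a n + b n) \<le> ennreal C * (lq_norm q a + lq_norm q b)"
  using assms
proof (cases rule: exponent_cases)
  case infinite
  show thesis
  proof (rule that[of 1])
    fix a b :: "nat \<Rightarrow> ennreal"
    show "lq_norm q (\<lambda>n. a n + b n) \<le> ennreal 1 * (lq_norm q a + lq_norm q b)"
      using infinite by (auto simp: lq_norm_infinity intro!: SUP_least add_mono SUP_upper)
  qed auto
next
  case (finite r)
  show thesis
  proof (rule that[of "2 * 2 powr (1 / r)"])
    fix a b :: "nat \<Rightarrow> ennreal"
    have "lq_norm q (\<lambda>n. a n + b n) \<le>
        ennpowr (\<Sum>n. ennreal (2 powr r) * (ennpowr (a n) r + ennpowr (b n) r)) (1 / r)"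
      using finite
      by (simp add: lq_norm_finite del: ennreal_suminf_cmult)
        (intro ennpowr_mono suminf_le ennpowr_add_le, auto)
    also have "\<dots> = 2 * ennpowr ((\<Sum>n. ennpowr (a n) r) + (\<Sum>n. ennpowr (b n) r)) (1 / r)"
      using finite
      by (simp add: ennpowr_mult ennreal_suminf_cmult suminf_add[symmetric] ennpowr_ennreal powr_powr)
    also have "\<dots> \<le> 2 * (ennreal (2 powr (1 / r)) * (lq_norm q a + lq_norm q b))"
      using finite by (intro mult_left_mono) (auto simp: lq_norm_finite intro: ennpowr_add_le)
    finally show "lq_norm q (\<lambda>n. a n + b n) \<le> ennreal (2 * 2 powr (1 / r)) * (lq_norm q a + lq_norm q b)"
      by (simp add: ennreal_mult mult.assoc)
  qed auto
qed

text \<open>A discrete Hardy inequality. The ratio \<open>1/4\<close> leaves room for the factor \<open>2\<close> lost when an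
  \<open>r\<close>-th power of a sum is split, so the same recursion argument serves all \<open>q > 0\<close>, without
  distinguishing \<open>q \<ge> 1\<close> (Minkowski) from \<open>q < 1\<close> (subadditivity).\<close>

lemma lq_norm_contractive_recursion:
  assumes "0 < q"
  obtains C :: real where "0 < C"
    "\<And>u v. (\<And>n. v (Suc n) \<le> ennreal (1 / 4) * (v n + u n)) \<Longrightarrow> lq_norm q v \<le> ennreal C * (v 0 + lq_norm q u)"
  using assms
proof (cases rule: exponent_cases)
  case infinite
  show thesis
  proof (rule that[of 1])
    fix u v :: "nat \<Rightarrow> ennreal"
    assume rec: "\<And>n. v (Suc n) \<le> ennreal (1 / 4) * (v n + u n)"
    have "v n \<le> v 0 + lq_norm q u" for n
    proof (induction n)
      case (Suc n)
      have "v (Suc n) \<le> ennreal (1 / 4) * ((v 0 + lq_norm q u) + (v 0 + lq_norm q u))"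
        using Suc lq_norm_ge_nth[OF assms, of u n]
        by (intro order_trans[OF rec] mult_left_mono add_mono) (auto intro: order_trans)
      also have "\<dots> = ennreal (1 / 2) * (v 0 + lq_norm q u)"
        by (simp add: mult_2[symmetric] mult.assoc[symmetric]
          flip: ennreal_numeral ennreal_mult)
      also have "\<dots> \<le> ennreal 1 * (v 0 + lq_norm q u)"
        by (intro mult_right_mono ennreal_leI) auto
      finally show ?case by simp
    qed auto
    then show "lq_norm q v \<le> ennreal 1 * (v 0 + lq_norm q u)"
      using infinite by (simp add: lq_norm_infinity[of v] SUP_least)
  qed auto
next
  case (finite r)
  define \<rho> where "\<rho> = 2 powr (- r)"
  define A where "A = 1 / (1 - \<rho>)"
  define B where "B = \<rho> / (1 - \<rho>)"
  have \<rho>: "0 < \<rho>" "\<rho> < 1"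
    using finite powr_less_cancel_iff[of 2 "- r" 0] by (auto simp: \<rho>_def simp del: powr_less_cancel_iff)
  then have AB: "0 < A" "0 < B" "A = 1 + B" "A * \<rho> = B" "B \<le> A"
    by (auto simp: A_def B_def divide_right_mono) (simp add: field_simps)
  define C where "C = A powr (1 / r) * 2 powr (1 / r)"
  show thesis
  proof (rule that[of C])
    fix u v :: "nat \<Rightarrow> ennreal"
    assume rec: "\<And>n. v (Suc n) \<le> ennreal (1 / 4) * (v n + u n)"
    have step: "ennpowr (v (Suc n)) r \<le> ennreal \<rho> * (ennpowr (v n) r + ennpowr (u n) r)" for n
    proof -
      have "ennpowr (v (Suc n)) r \<le> ennpowr (ennreal (1 / 4)) r * ennpowr (v n + u n) r"
        using ennpowr_mono[OF \<open>r > 0\<close> rec] \<open>r > 0\<close> by (simp add: ennpowr_mult)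
      also have "\<dots> \<le> ennpowr (ennreal (1 / 4)) r * (ennreal (2 powr r) * (ennpowr (v n) r + ennpowr (u n) r))"
        using \<open>r > 0\<close> by (intro mult_left_mono ennpowr_add_le) auto
      also have "\<dots> = ennreal ((1 / 4) powr r * 2 powr r) * (ennpowr (v n) r + ennpowr (u n) r)"
        by (subst ennpowr_ennreal) (auto simp: ennreal_mult mult.assoc)
      also have "(1 / 4) powr r * 2 powr r = \<rho>"
        using powr_mult[of "1 / 4" 2 r] by (simp add: \<rho>_def powr_minus_divide powr_divide)
      finally show ?thesis .
    qed
    \<comment> \<open>Adding \<open>B\<close> times the last term makes the estimate inductive and avoids subtracting sums that
      might be infinite.\<close>
    have sums: "(\<Sum>n\<le>N. ennpowr (v n) r) + ennreal B * ennpowr (v N) r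
        \<le> ennreal A * ennpowr (v 0) r + ennreal B * (\<Sum>n<N. ennpowr (u n) r)" for N
    proof (induction N)
      case 0
      have "ennpowr (v 0) r + ennreal B * ennpowr (v 0) r = ennreal A * ennpowr (v 0) r"
        using AB by (simp add: distrib_right)
      then show ?case by simp
    next
      case (Suc N)
      have "ennpowr (v (Suc N)) r + ennreal B * ennpowr (v (Suc N)) r = ennreal A * ennpowr (v (Suc N)) r"
        using AB by (simp add: distrib_right)
      also have "\<dots> \<le> ennreal A * (ennreal \<rho> * (ennpowr (v N) r + ennpowr (u N) r))"
        by (intro mult_left_mono step) auto
      also have "\<dots> = ennreal B * (ennpowr (v N) r + ennpowr (u N) r)"
        using AB(1,2,4) \<rho>(1)
        by (subst mult.assoc[symmetric], subst ennreal_mult'[symmetric]) simp_all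
      finally have "(\<Sum>n\<le>N. ennpowr (v n) r) + (ennpowr (v (Suc N)) r + ennreal B * ennpowr (v (Suc N)) r)
          \<le> (\<Sum>n\<le>N. ennpowr (v n) r) + ennreal B * (ennpowr (v N) r + ennpowr (u N) r)"
        by (rule add_left_mono)
      also have "\<dots> = ((\<Sum>n\<le>N. ennpowr (v n) r) + ennreal B * ennpowr (v N) r) + ennreal B * ennpowr (u N) r"
        by (simp add: distrib_left add.assoc)
      also have "\<dots> \<le> (ennreal A * ennpowr (v 0) r + ennreal B * (\<Sum>n<N. ennpowr (u n) r))
          + ennreal B * ennpowr (u N) r"
        by (intro add_right_mono Suc)
      finally show ?case
        by (simp add: distrib_left add.assoc)
    qed
    have "(\<Sum>n<N. ennpowr (v n) r) \<le> ennreal A * (ennpowr (v 0) r + (\<Sum>n. ennpowr (u n) r))" for N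
    proof -
      have "(\<Sum>n<N. ennpowr (v n) r) \<le> (\<Sum>n\<le>N. ennpowr (v n) r)"
        by (intro sum_mono2) auto
      also have "\<dots> \<le> ennreal A * ennpowr (v 0) r + ennreal B * (\<Sum>n<N. ennpowr (u n) r)"
        using sums[of N] by (rule order_trans[rotated]) simp
      also have "\<dots> \<le> ennreal A * ennpowr (v 0) r + ennreal A * (\<Sum>n. ennpowr (u n) r)"
        using AB by (intro add_mono mult_mono sum_le_suminf ennreal_leI) auto
      finally show ?thesis by (simp add: distrib_left)
    qed
    then have "(\<Sum>n. ennpowr (v n) r) \<le> ennreal A * (ennpowr (v 0) r + (\<Sum>n. ennpowr (u n) r))"
      by (intro suminf_le_const) auto
    then have "lq_norm q v \<le> ennpowr (ennreal A * (ennpowr (v 0) r + (\<Sum>n. ennpowr (u n) r))) (1 / r)"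
      using finite by (auto simp: lq_norm_finite intro: ennpowr_mono)
    also have "\<dots> \<le> ennreal (A powr (1 / r)) * (ennreal (2 powr (1 / r)) * (v 0 + lq_norm q u))"
    proof -
      have "ennpowr (ennpowr (v 0) r + (\<Sum>n. ennpowr (u n) r)) (1 / r)
          \<le> ennreal (2 powr (1 / r)) * (v 0 + lq_norm q u)"
        using ennpowr_add_le[of "1 / r" "ennpowr (v 0) r" "\<Sum>n. ennpowr (u n) r"] finite
        by (simp add: lq_norm_finite)
      then show ?thesis
        using finite AB(1) by (simp add: ennpowr_mult ennpowr_ennreal mult_left_mono)
    qed
    finally show "lq_norm q v \<le> ennreal C * (v 0 + lq_norm q u)"
      by (simp add: C_def ennreal_mult mult.assoc)
  qed (use AB in \<open>auto simp: C_def\<close>)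
qed

section \<open>Discretisation of the interpolation quasi-norm\<close>

lemma K_functional_mono: "s \<le> t \<Longrightarrow> K_functional NX Y NY f s \<le> K_functional NX Y NY f t"
  unfolding K_functional_def
  by (intro INF_mono' add_left_mono mult_right_mono ennreal_leI) auto

text \<open>For \<open>b > 1\<close> these intervals partition the positive half line, and all have the same mass with respect to
  \<open>dt / t\<close>.\<close>

definition geometric_interval :: "real \<Rightarrow> int \<Rightarrow> real set" where
  "geometric_interval b i = {b powr of_int i ..< b powr (of_int i + 1)}"

lemma geometric_interval_sets [measurable]: "geometric_interval b i \<in> sets borel"
  by (simp add: geometric_interval_def)

lemma emeasure_geometric_interval:
  assumes "b > 1"
  shows "emeasure lborel (geometric_interval b i) = ennreal ((b - 1) * b powr of_int i)"
  using assms by (simp add: geometric_interval_def powr_add algebra_simps)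

lemma geometric_interval_cover:
  assumes "b > 1" "t > 0" obtains i where "t \<in> geometric_interval b i"
proof -
  have "of_int \<lfloor>log b t\<rfloor> \<le> log b t" "log b t < of_int \<lfloor>log b t\<rfloor> + 1"
    by linarith+
  then have "t \<in> geometric_interval b \<lfloor>log b t\<rfloor>"
    using assms by (simp add: geometric_interval_def powr_le_iff less_powr_iff)
  then show thesis by (rule that)
qed

lemma geometric_interval_unique:
  assumes "b > 1" "t \<in> geometric_interval b i" "t \<in> geometric_interval b j" shows "i = j"
proof -
  have "b powr of_int i < b powr (of_int j + 1)" "b powr of_int j < b powr (of_int i + 1)"
    using assms(2,3) by (auto simp: geometric_interval_def intro: order_le_less_trans)
  then have "real_of_int i < of_int j + 1" "real_of_int j < of_int i + 1"
    by (simp_all only: powr_less_cancel_iff[OF assms(1)])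
  then show ?thesis by linarith
qed

lemma disjoint_geometric_intervals:
  assumes "b > 1" "inj \<phi>" shows "disjoint_family (\<lambda>n. geometric_interval b (\<phi> n))"
  using geometric_interval_unique[OF assms(1)] assms(2)
  by (fastforce simp: disjoint_family_on_def inj_def)

lemma geometric_interval_bounds:
  assumes "b > 1" "t \<in> geometric_interval b i" "\<theta> \<ge> 0"
  shows "0 < t" "b powr (- (of_int i + 1) * \<theta>) \<le> t powr (- \<theta>)" "t powr (- \<theta>) \<le> b powr (- of_int i * \<theta>)"
    "b powr (- (of_int i + 1)) \<le> 1 / t" "1 / t \<le> b powr (- of_int i)"
proof -
  have t: "b powr of_int i \<le> t" "t < b powr (of_int i + 1)" and b: "0 < b powr of_int i"
    using assms by (auto simp: geometric_interval_def)
  show pos: "0 < t"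
    using b t by linarith
  show "b powr (- (of_int i + 1) * \<theta>) \<le> t powr (- \<theta>)"
    using powr_mono2'[of "- \<theta>" t "b powr (of_int i + 1)"] assms t pos by (simp add: powr_powr algebra_simps)
  show "t powr (- \<theta>) \<le> b powr (- of_int i * \<theta>)"
    using powr_mono2'[of "- \<theta>" "b powr of_int i" t] assms t b by (simp add: powr_powr)
  show "b powr (- (of_int i + 1)) \<le> 1 / t"
    using frac_le[of 1 1 t "b powr (of_int i + 1)"] t(2) pos unfolding powr_minus_divide by simp
  show "1 / t \<le> b powr (- of_int i)"
    using t pos b unfolding powr_minus_divide by (intro frac_le) auto
qed

lemma nn_integral_geometric_step:
  fixes c :: "nat \<Rightarrow> ennreal"
  assumes "b > 1"
  shows "(\<integral>\<^sup>+t. (\<Sum>n. c n * indicator (geometric_interval b (\<phi> n)) t) \<partial>lborel)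
    = ennreal (b - 1) * (\<Sum>n. c n * ennreal (b powr of_int (\<phi> n)))"
proof -
  have "(\<integral>\<^sup>+t. (\<Sum>n. c n * indicator (geometric_interval b (\<phi> n)) t) \<partial>lborel)
      = (\<Sum>n. c n * emeasure lborel (geometric_interval b (\<phi> n)))"
    by (subst nn_integral_suminf) (auto simp: nn_integral_cmult_indicator)
  also have "\<dots> = (\<Sum>n. ennreal (b - 1) * (c n * ennreal (b powr of_int (\<phi> n))))"
    using assms by (simp add: emeasure_geometric_interval ennreal_mult' mult.left_commute)
  finally show ?thesis by simp
qed

text \<open>On \<open>geometric_interval b i\<close> the weight \<open>t powr - \<theta>\<close> and the density \<open>1 / t\<close> vary by constant
  factors only, and \<open>K\<close> is monotone. So the integrand lies between step functions, which are
  measurable even if \<open>K\<close> itself is not known to be.\<close>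

lemma discrete_le_interp_norm:
  assumes "0 < q" "b > 1" "\<theta> > 0"
  obtains C :: real where "0 < C"
    "\<And>NX Y NY f. lq_norm q (\<lambda>n. ennreal (b powr (real n * \<theta>)) * K_functional NX Y NY f (b powr - real n))
      \<le> ennreal C * interp_norm NX Y NY \<theta> q f"
  using assms(1)
proof (cases rule: exponent_cases)
  case infinite
  show thesis
  proof (rule that[of 1])
    fix NX :: "'a \<Rightarrow> ennreal" and Y NY f
    show "lq_norm q (\<lambda>n. ennreal (b powr (real n * \<theta>)) * K_functional NX Y NY f (b powr - real n))
      \<le> ennreal 1 * interp_norm NX Y NY \<theta> q f"
      using infinite assms
      by (auto simp: lq_norm_infinity interp_norm_def powr_powr
          intro!: SUP_least SUP_upper2[of "b powr - real _"])
  qed auto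
next
  case (finite r)
  \<comment> \<open>The factor \<open>b powr (\<theta> * r)\<close> stems from the weight and \<open>b / (b - 1)\<close> from the density \<open>1 / t\<close>.\<close>
  define C where "C = (b powr (\<theta> * r + 1) / (b - 1)) powr (1 / r)"
  show thesis
  proof (rule that[of C])
    fix NX :: "'a \<Rightarrow> ennreal" and Y NY f
    define K where "K = K_functional NX Y NY f"
    define a where "a n = ennreal (b powr (real n * \<theta>)) * K (b powr - real n)" for n :: nat
    define G where "G t = ennpowr (ennreal (t powr (- \<theta>)) * K t) r * ennreal (1 / t) * indicator {0<..} t" for t
    define c where "c n = ennreal (b powr (- \<theta> * r)) * ennpowr (a n) r * ennreal (b powr (real n - 1))" for n :: nat
    define \<phi> where "\<phi> n = - int n" for n :: nat
    have \<phi>: "inj \<phi>"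
      by (auto simp: \<phi>_def inj_def)
    have "(\<Sum>n. c n * indicator (geometric_interval b (\<phi> n)) t) \<le> G t" for t
    proof (cases "\<exists>n. t \<in> geometric_interval b (\<phi> n)")
      case True
      then obtain n where n: "t \<in> geometric_interval b (\<phi> n)" by blast
      note bounds = geometric_interval_bounds[OF assms(2) n, of \<theta>]
      have "ennreal (b powr - \<theta>) * a n = ennreal (b powr (- (of_int (\<phi> n) + 1) * \<theta>)) * K (b powr - real n)"
        unfolding a_def \<phi>_def mult.assoc[symmetric]
        by (subst ennreal_mult'[symmetric]) (auto simp: powr_add[symmetric] algebra_simps)
      also have "\<dots> \<le> ennreal (t powr - \<theta>) * K t"
        unfolding K_def using bounds(2) n assms
        by (intro mult_mono ennreal_leI K_functional_mono) (auto simp: \<phi>_def geometric_interval_def)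
      finally have "ennpowr (ennreal (b powr - \<theta>) * a n) r \<le> ennpowr (ennreal (t powr - \<theta>) * K t) r"
        using finite by (intro ennpowr_mono)
      then have "c n \<le> G t"
        unfolding c_def G_def using bounds(1,4) assms finite
        by (auto simp: ennpowr_mult ennpowr_ennreal powr_powr \<phi>_def intro!: mult_mono ennreal_leI)
      then show ?thesis
        by (subst suminf_cmult_indicator[OF disjoint_geometric_intervals[OF assms(2) \<phi>] n]) auto
    qed auto
    then have "(\<integral>\<^sup>+t. (\<Sum>n. c n * indicator (geometric_interval b (\<phi> n)) t) \<partial>lborel) \<le> (\<integral>\<^sup>+t. G t \<partial>lborel)"
      by (rule nn_integral_mono)
    also have "(\<integral>\<^sup>+t. (\<Sum>n. c n * indicator (geometric_interval b (\<phi> n)) t) \<partial>lborel)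
        = ennreal (b - 1) * (\<Sum>n. c n * ennreal (b powr of_int (\<phi> n)))"
      using assms(2) by (rule nn_integral_geometric_step)
    also have "(\<lambda>n. c n * ennreal (b powr of_int (\<phi> n)))
        = (\<lambda>n. ennreal (b powr - (\<theta> * r + 1)) * ennpowr (a n) r)"
    proof
      fix n
      have "c n * ennreal (b powr of_int (\<phi> n))
          = ennreal (b powr (- \<theta> * r) * b powr (real n - 1) * b powr - real n) * ennpowr (a n) r"
        by (simp add: c_def \<phi>_def ennreal_mult mult_ac)
      also have "b powr (- \<theta> * r) * b powr (real n - 1) * b powr - real n = b powr - (\<theta> * r + 1)"
        by (simp add: powr_add[symmetric] algebra_simps)
      finally show "c n * ennreal (b powr of_int (\<phi> n)) = ennreal (b powr - (\<theta> * r + 1)) * ennpowr (a n) r" .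
    qed
    finally have int: "ennreal (b - 1) * (ennreal (b powr - (\<theta> * r + 1)) * (\<Sum>n. ennpowr (a n) r))
        \<le> (\<integral>\<^sup>+t. G t \<partial>lborel)"
      by simp
    have "(\<Sum>n. ennpowr (a n) r)
        = ennreal (C powr r) * (ennreal (b - 1) * (ennreal (b powr - (\<theta> * r + 1)) * (\<Sum>n. ennpowr (a n) r)))"
    proof -
      have "C powr r * (b - 1) * b powr - (\<theta> * r + 1) = 1"
        using assms finite by (simp add: C_def powr_powr flip: powr_add)
      then show ?thesis
        using assms by (simp add: mult.assoc[symmetric] flip: ennreal_mult)
    qed
    also have "\<dots> \<le> ennreal (C powr r) * (\<integral>\<^sup>+t. G t \<partial>lborel)"
      by (intro mult_left_mono int) auto
    finally have "lq_norm q a \<le> ennpowr (ennreal (C powr r) * (\<integral>\<^sup>+t. G t \<partial>lborel)) (1 / r)"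
      using finite by (auto simp: lq_norm_finite intro: ennpowr_mono)
    also have "\<dots> = ennreal C * interp_norm NX Y NY \<theta> q f"
      using finite assms
      by (simp add: ennpowr_mult ennpowr_ennreal powr_powr interp_norm_def G_def K_def C_def mult.assoc)
    finally show "lq_norm q (\<lambda>n. ennreal (b powr (real n * \<theta>)) * K_functional NX Y NY f (b powr - real n))
        \<le> ennreal C * interp_norm NX Y NY \<theta> q f"
      by (simp add: a_def[abs_def] K_def)
  qed (use assms in \<open>auto simp: C_def\<close>)
qed

lemma interp_norm_le_discrete:
  assumes "0 < q" "b > 1" "\<theta> > 0"
  obtains C :: real where "0 < C"
    "\<And>NX Y NY f. (\<And>t. K_functional NX Y NY f t \<le> NX f) \<Longrightarrow> interp_norm NX Y NY \<theta> q f \<le> ennreal C *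
      (NX f + lq_norm q (\<lambda>n. ennreal (b powr (real n * \<theta>)) * K_functional NX Y NY f (b powr - real n)))"
  using assms(1)
proof (cases rule: exponent_cases)
  case infinite
  show thesis
  proof (rule that[of "b powr \<theta>"])
    fix NX :: "'a \<Rightarrow> ennreal" and Y NY f
    assume bound: "\<And>t. K_functional NX Y NY f t \<le> NX f"
    define K where "K = K_functional NX Y NY f"
    define a where "a n = ennreal (b powr (real n * \<theta>)) * K (b powr - real n)" for n :: nat
    have "ennreal (t powr - \<theta>) * K t \<le> ennreal (b powr \<theta>) * (NX f + lq_norm q a)" if "t > 0" for t
    proof -
      obtain i where i: "t \<in> geometric_interval b i"
        using geometric_interval_cover[OF assms(2) \<open>t > 0\<close>] .
      note bounds = geometric_interval_bounds[OF assms(2) i, of \<theta>]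
      show ?thesis
      proof (cases "i \<ge> 0")
        case True
        have "b powr (- of_int i * \<theta>) \<le> b powr \<theta>"
          using True assms by (intro powr_mono mult_right_mono[of _ 1 \<theta>, simplified]) auto
        then have "t powr - \<theta> \<le> b powr \<theta>"
          using bounds(3) assms(3) by linarith
        then have "ennreal (t powr - \<theta>) * K t \<le> ennreal (b powr \<theta>) * NX f"
          using bound by (intro mult_mono ennreal_leI) (auto simp: K_def)
        also have "\<dots> \<le> ennreal (b powr \<theta>) * (NX f + lq_norm q a)"
          by (intro mult_left_mono) auto
        finally show ?thesis .
      next
        case False
        then obtain n where n: "i = - int n - 1"
          by (intro that[of "nat (- i - 1)"]) auto
        have "ennreal (t powr - \<theta>) * K t \<le> ennreal (b powr (- of_int i * \<theta>)) * K (b powr - real n)"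
          unfolding K_def using bounds(3) assms i n
          by (intro mult_mono ennreal_leI K_functional_mono) (auto simp: geometric_interval_def)
        also have "\<dots> = ennreal (b powr \<theta>) * a n"
          by (simp add: a_def n mult.assoc[symmetric] powr_add[symmetric] algebra_simps flip: ennreal_mult)
        also have "\<dots> \<le> ennreal (b powr \<theta>) * (NX f + lq_norm q a)"
          using lq_norm_ge_nth[OF assms(1), of a n] by (intro mult_left_mono) (auto intro: add_increasing)
        finally show ?thesis .
      qed
    qed
    then have "interp_norm NX Y NY \<theta> q f \<le> ennreal (b powr \<theta>) * (NX f + lq_norm q a)"
      using infinite by (auto simp: interp_norm_def K_def intro!: SUP_least)
    then show "interp_norm NX Y NY \<theta> q f \<le> ennreal (b powr \<theta>) *
      (NX f + lq_norm q (\<lambda>n. ennreal (b powr (real n * \<theta>)) * K_functional NX Y NY f (b powr - real n)))"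
      by (simp add: a_def[abs_def] K_def)
  qed (use assms in auto)
next
  case (finite r)
  \<comment> \<open>The first entry serves \<open>t < 1\<close>; the second is the geometric series that bounds the part \<open>t \<ge> 1\<close>,
    where \<open>K\<close> is at most \<open>NX f\<close>.\<close>
  define D where "D = max (b powr (\<theta> * r)) (1 / (1 - b powr (- \<theta> * r)))"
  have pos: "0 < D" and less_1: "b powr (- \<theta> * r) < 1"
    using assms finite powr_less_cancel_iff[of b "- \<theta> * r" 0] by (auto simp: D_def less_max_iff_disj)
  define C where "C = ((b - 1) * D) powr (1 / r) * 2 powr (1 / r)"
  show thesis
  proof (rule that[of C])
    fix NX :: "'a \<Rightarrow> ennreal" and Y NY f
    assume bound: "\<And>t. K_functional NX Y NY f t \<le> NX f"
    define K where "K = K_functional NX Y NY f"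
    define a where "a n = ennreal (b powr (real n * \<theta>)) * K (b powr - real n)" for n :: nat
    define G where "G t = ennpowr (ennreal (t powr (- \<theta>)) * K t) r * ennreal (1 / t) * indicator {0<..} t" for t
    define c where "c n = ennreal (b powr (\<theta> * r)) * ennpowr (a n) r * ennreal (b powr (real n + 1))" for n :: nat
    define d where "d n = ennreal (b powr (- real n * \<theta> * r)) * ennpowr (NX f) r * ennreal (b powr (- real n))" for n :: nat
    define \<phi> where "\<phi> n = - int n - 1" for n :: nat
    have \<phi>: "inj \<phi>"
      by (auto simp: \<phi>_def inj_def)
    have "G t \<le> (\<Sum>n. c n * indicator (geometric_interval b (\<phi> n)) t)
        + (\<Sum>n. d n * indicator (geometric_interval b (int n)) t)" for t
    proof (cases "t > 0")
      case True
      obtain i where i: "t \<in> geometric_interval b i"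
        using geometric_interval_cover[OF assms(2) \<open>t > 0\<close>] .
      note bounds = geometric_interval_bounds[OF assms(2) i, of \<theta>]
      show ?thesis
      proof (cases "i \<ge> 0")
        case True
        then obtain n where n: "i = int n"
          by (auto dest: nonneg_int_cases)
        have "ennreal (t powr - \<theta>) * K t \<le> ennreal (b powr (- real n * \<theta>)) * NX f"
          using bounds(3) assms bound n by (intro mult_mono ennreal_leI) (auto simp: K_def)
        then have "ennpowr (ennreal (t powr - \<theta>) * K t) r \<le> ennpowr (ennreal (b powr (- real n * \<theta>)) * NX f) r"
          using finite by (intro ennpowr_mono)
        then have "G t \<le> d n"
          unfolding d_def G_def using bounds(1,5) n assms finite
          by (auto simp: ennpowr_mult ennpowr_ennreal powr_powr intro!: mult_mono ennreal_leI)
        also have "d n = (\<Sum>n. d n * indicator (geometric_interval b (int n)) t)"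
          by (rule suminf_cmult_indicator[symmetric, OF disjoint_geometric_intervals[OF assms(2)]])
            (use i n in auto)
        finally show ?thesis
          by (rule add_increasing[rotated]) simp
      next
        case False
        then obtain n where n: "i = \<phi> n"
          by (intro that[of "nat (- i - 1)"]) (auto simp: \<phi>_def)
        have "ennreal (t powr - \<theta>) * K t \<le> ennreal (b powr (- of_int i * \<theta>)) * K (b powr - real n)"
          unfolding K_def using bounds(3) assms i n
          by (intro mult_mono ennreal_leI K_functional_mono) (auto simp: geometric_interval_def \<phi>_def)
        also have "\<dots> = ennreal (b powr \<theta>) * a n"
          by (simp add: a_def n \<phi>_def mult.assoc[symmetric] powr_add[symmetric] algebra_simps flip: ennreal_mult)
        finally have "ennpowr (ennreal (t powr - \<theta>) * K t) r \<le> ennpowr (ennreal (b powr \<theta>) * a n) r"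
          using finite by (intro ennpowr_mono)
        then have "G t \<le> c n"
          unfolding c_def G_def using bounds(1,5) n assms finite
          by (auto simp: ennpowr_mult ennpowr_ennreal powr_powr \<phi>_def add.commute intro!: mult_mono ennreal_leI)
        also have "c n = (\<Sum>n. c n * indicator (geometric_interval b (\<phi> n)) t)"
          by (rule suminf_cmult_indicator[symmetric, OF disjoint_geometric_intervals[OF assms(2) \<phi>]])
            (use i n in auto)
        finally show ?thesis
          by (rule add_increasing2[rotated]) simp
      qed
    qed (simp add: G_def)
    then have "(\<integral>\<^sup>+t. G t \<partial>lborel) \<le> (\<integral>\<^sup>+t. (\<Sum>n. c n * indicator (geometric_interval b (\<phi> n)) t)
        + (\<Sum>n. d n * indicator (geometric_interval b (int n)) t) \<partial>lborel)"
      by (rule nn_integral_mono)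
    also have "\<dots> = (\<integral>\<^sup>+t. (\<Sum>n. c n * indicator (geometric_interval b (\<phi> n)) t) \<partial>lborel)
        + (\<integral>\<^sup>+t. (\<Sum>n. d n * indicator (geometric_interval b (int n)) t) \<partial>lborel)"
      by (rule nn_integral_add) measurable
    also have "\<dots> = ennreal (b - 1) * ((\<Sum>n. c n * ennreal (b powr of_int (\<phi> n)))
        + (\<Sum>n. d n * ennreal (b powr of_int (int n))))"
      unfolding nn_integral_geometric_step[OF assms(2)] by (simp only: distrib_left)
    also have "(\<lambda>n. c n * ennreal (b powr of_int (\<phi> n))) = (\<lambda>n. ennreal (b powr (\<theta> * r)) * ennpowr (a n) r)"
    proof
      fix n
      have "c n * ennreal (b powr of_int (\<phi> n))
          = ennreal (b powr (\<theta> * r) * (b powr (real n + 1) * b powr (- real n - 1))) * ennpowr (a n) r"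
        by (simp add: c_def \<phi>_def ennreal_mult mult_ac)
      also have "b powr (real n + 1) * b powr (- real n - 1) = 1"
        using assms by (simp add: powr_add[symmetric])
      finally show "c n * ennreal (b powr of_int (\<phi> n)) = ennreal (b powr (\<theta> * r)) * ennpowr (a n) r"
        by simp
    qed
    also have "(\<lambda>n. d n * ennreal (b powr of_int (int n)))
        = (\<lambda>n. ennpowr (NX f) r * ennreal ((b powr (- \<theta> * r)) ^ n))"
    proof
      fix n
      have "d n * ennreal (b powr of_int (int n))
          = ennreal (b powr (- real n * \<theta> * r) * (b powr real n * b powr - real n)) * ennpowr (NX f) r"
        by (simp add: d_def ennreal_mult mult_ac)
      also have "b powr real n * b powr - real n = 1"
        using assms by (simp add: powr_add[symmetric])
      also have "b powr (- real n * \<theta> * r) * 1 = (b powr (- \<theta> * r)) ^ n"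
        using assms(2) by (simp add: powr_power mult_ac)
      finally show "d n * ennreal (b powr of_int (int n)) = ennpowr (NX f) r * ennreal ((b powr (- \<theta> * r)) ^ n)"
        by (simp add: mult.commute)
    qed
    finally have "(\<integral>\<^sup>+t. G t \<partial>lborel) \<le> ennreal (b - 1) * (ennreal (b powr (\<theta> * r)) * (\<Sum>n. ennpowr (a n) r)
        + ennpowr (NX f) r * (\<Sum>n. ennreal ((b powr (- \<theta> * r)) ^ n)))"
      by simp
    also have "(\<Sum>n. ennreal ((b powr (- \<theta> * r)) ^ n)) = ennreal (1 / (1 - b powr (- \<theta> * r)))"
      using less_1 suminf_geometric[of "b powr (- \<theta> * r)"]
      by (subst suminf_ennreal2) (auto intro: summable_geometric)
    also have "ennreal (b - 1) * (ennreal (b powr (\<theta> * r)) * (\<Sum>n. ennpowr (a n) r)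
        + ennpowr (NX f) r * ennreal (1 / (1 - b powr (- \<theta> * r))))
      \<le> ennreal (b - 1) * (ennreal D * (\<Sum>n. ennpowr (a n) r) + ennpowr (NX f) r * ennreal D)"
      by (intro mult_left_mono mult_right_mono add_mono ennreal_leI) (auto simp: D_def)
    also have "\<dots> = ennreal ((b - 1) * D) * (ennpowr (NX f) r + (\<Sum>n. ennpowr (a n) r))"
      using assms pos by (simp add: ennreal_mult distrib_left mult_ac add.commute)
    finally have "interp_norm NX Y NY \<theta> q f
        \<le> ennpowr (ennreal ((b - 1) * D) * (ennpowr (NX f) r + (\<Sum>n. ennpowr (a n) r))) (1 / r)"
      using finite by (auto simp: interp_norm_def G_def K_def mult.assoc intro: ennpowr_mono)
    also have "\<dots> = ennreal (((b - 1) * D) powr (1 / r)) * ennpowr (ennpowr (NX f) r + (\<Sum>n. ennpowr (a n) r)) (1 / r)"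
      using finite assms pos by (subst ennpowr_mult) (auto simp: ennpowr_ennreal)
    also have "\<dots> \<le> ennreal (((b - 1) * D) powr (1 / r)) * (ennreal (2 powr (1 / r)) * (NX f + lq_norm q a))"
      using ennpowr_add_le[of "1 / r" "ennpowr (NX f) r" "\<Sum>n. ennpowr (a n) r"] finite
      by (intro mult_left_mono) (auto simp: lq_norm_finite)
    finally show "interp_norm NX Y NY \<theta> q f \<le> ennreal C *
      (NX f + lq_norm q (\<lambda>n. ennreal (b powr (real n * \<theta>)) * K_functional NX Y NY f (b powr - real n)))"
      by (simp add: C_def a_def[abs_def] K_def ennreal_mult mult.assoc)
  qed (use assms pos in \<open>auto simp: C_def\<close>)
qed

section \<open>Jackson and Bernstein inequalities imply the interpolation identity\<close>

text \<open>Infima over competitors (in \<open>K\<close>, in the error of best approximation, in the local error) need not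
  be attained. An estimate that is affine in the competitor's error passes to the infimum directly,
  without choosing near-best competitors.\<close>

lemma le_affine_INF:
  fixes h :: "'i \<Rightarrow> ennreal"
  assumes "I \<noteq> {}" "\<And>i. i \<in> I \<Longrightarrow> x \<le> a + ennreal c * h i"
  shows "x \<le> a + ennreal c * (INF i\<in>I. h i)"
proof -
  let ?\<phi> = "\<lambda>y. a + ennreal c * y"
  have "(?\<phi> \<longlongrightarrow> ?\<phi> y) (at_right y)" for y
    by (intro tendsto_intros ennreal_tendsto_cmult) auto
  then have "?\<phi> (Inf (h ` I)) = (INF y\<in>h ` I. ?\<phi> y)"
    using assms(1)
    by (intro continuous_at_Inf_mono) (auto simp: mono_def continuous_within intro!: add_left_mono mult_left_mono)
  also have "x \<le> \<dots>"
    using assms(2) by (auto intro: INF_greatest)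
  finally show ?thesis .
qed

lemma le_cmult_add_INF:
  fixes h :: "'i \<Rightarrow> ennreal"
  assumes "I \<noteq> {}" "\<And>i. i \<in> I \<Longrightarrow> x \<le> ennreal c * (a + h i)"
  shows "x \<le> ennreal c * (a + (INF i\<in>I. h i))"
  using le_affine_INF[of I x "ennreal c * a" c h] assms by (simp add: distrib_left)

text \<open>Hides the constants, so that estimates can be chained by transitivity.\<close>

definition dominated_on :: "'v set \<Rightarrow> ('v \<Rightarrow> ennreal) \<Rightarrow> ('v \<Rightarrow> ennreal) \<Rightarrow> bool" where
  "dominated_on X N1 N2 \<longleftrightarrow> (\<exists>C::real. 0 < C \<and> (\<forall>x\<in>X. N1 x \<le> ennreal C * N2 x))"

lemma dominated_onI: "0 < C \<Longrightarrow> (\<And>x. x \<in> X \<Longrightarrow> N1 x \<le> ennreal C * N2 x) \<Longrightarrow> dominated_on X N1 N2"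
  by (auto simp: dominated_on_def)

lemma dominated_on_le: "(\<And>x. x \<in> X \<Longrightarrow> N1 x \<le> N2 x) \<Longrightarrow> dominated_on X N1 N2"
  by (rule dominated_onI[of 1]) auto

lemma dominated_on_trans [trans]:
  assumes "dominated_on X N1 N2" "dominated_on X N2 N3" shows "dominated_on X N1 N3"
proof -
  obtain C1 C2 :: real where C: "0 < C1" "0 < C2"
    "\<And>x. x \<in> X \<Longrightarrow> N1 x \<le> ennreal C1 * N2 x" "\<And>x. x \<in> X \<Longrightarrow> N2 x \<le> ennreal C2 * N3 x"
    using assms by (auto simp: dominated_on_def)
  show ?thesis
  proof (rule dominated_onI[of "C1 * C2"])
    fix x assume "x \<in> X"
    then have "N1 x \<le> ennreal C1 * (ennreal C2 * N3 x)"
      using C by (meson mult_left_mono order_trans zero_le)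
    then show "N1 x \<le> ennreal (C1 * C2) * N3 x"
      using C by (simp add: ennreal_mult mult.assoc)
  qed (use C in auto)
qed

lemma dominated_on_add:
  assumes "dominated_on X N1 N" "dominated_on X N2 N" shows "dominated_on X (\<lambda>x. N1 x + N2 x) N"
proof -
  obtain C1 C2 :: real where C: "0 < C1" "0 < C2"
    "\<And>x. x \<in> X \<Longrightarrow> N1 x \<le> ennreal C1 * N x" "\<And>x. x \<in> X \<Longrightarrow> N2 x \<le> ennreal C2 * N x"
    using assms by (auto simp: dominated_on_def)
  show ?thesis
    by (rule dominated_onI[of "C1 + C2"]) (use C in \<open>auto simp: distrib_right intro: add_mono\<close>)
qed

lemma dominated_on_finite: "dominated_on X N1 N2 \<Longrightarrow> x \<in> X \<Longrightarrow> N2 x < \<infinity> \<Longrightarrow> N1 x < \<infinity>"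
  unfolding dominated_on_def
  by (metis ennreal_less_top ennreal_mult_less_top infinity_ennreal_def order_le_less_trans)

lemma equivalent_onI: "dominated_on X N1 N2 \<Longrightarrow> dominated_on X N2 N1 \<Longrightarrow> equivalent_on X N1 N2"
proof -
  assume "dominated_on X N1 N2" "dominated_on X N2 N1"
  then obtain C1 C2 :: real where C: "0 < C1" "0 < C2"
    "\<And>x. x \<in> X \<Longrightarrow> N1 x \<le> ennreal C1 * N2 x" "\<And>x. x \<in> X \<Longrightarrow> N2 x \<le> ennreal C2 * N1 x"
    by (auto simp: dominated_on_def)
  have "ennreal (1 / C1) * N1 x \<le> N2 x" if "x \<in> X" for x
  proof -
    have "ennreal (1 / C1) * N1 x \<le> ennreal (1 / C1) * (ennreal C1 * N2 x)"
      using C(3)[OF that] by (intro mult_left_mono) auto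
    also have "\<dots> = N2 x"
      using C(1) by (simp add: mult.assoc[symmetric] flip: ennreal_mult)
    finally show ?thesis .
  qed
  then show ?thesis
    using C unfolding equivalent_on_def by (intro exI[of _ "1 / C1"] exI[of _ C2]) auto
qed

lemma dominated_on_subset: "dominated_on X N1 N2 \<Longrightarrow> Y \<subseteq> X \<Longrightarrow> dominated_on Y N1 N2"
  by (auto simp: dominated_on_def)

lemma n_term_mono:
  assumes "m \<le> n" "0 \<in> D" shows "n_term m D \<subseteq> n_term n D"
proof
  fix x assume "x \<in> n_term m D"
  then obtain c d where x: "x = (\<Sum>i<m. fscale (c i) (d i))" "\<forall>i<m. d i \<in> D"
    by (auto simp: n_term_def)
  let ?d = "\<lambda>i. if i < m then d i else 0"
  have "x = (\<Sum>i<n. fscale (c i) (?d i))"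
    using assms(1) unfolding x(1)
    by (intro sum.mono_neutral_cong_left) (auto simp: fscale_def zero_fun_def)
  then show "x \<in> n_term n D"
    using x(2) assms(2) unfolding n_term_def by (intro CollectI exI[of _ c] exI[of _ ?d]) auto
qed

lemma n_term_add:
  assumes "x \<in> n_term m D" "y \<in> n_term n D" shows "x + y \<in> n_term (m + n) D"
proof -
  obtain c d where x: "x = (\<Sum>i<m. fscale (c i) (d i))" "\<forall>i<m. d i \<in> D"
    using assms by (auto simp: n_term_def)
  obtain c' d' where y: "y = (\<Sum>i<n. fscale (c' i) (d' i))" "\<forall>i<n. d' i \<in> D"
    using assms by (auto simp: n_term_def)
  let ?c = "\<lambda>i. if i < m then c i else c' (i - m)" and ?d = "\<lambda>i. if i < m then d i else d' (i - m)"
  have "(\<Sum>i<m + n. fscale (?c i) (?d i))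
      = (\<Sum>i<m. fscale (?c i) (?d i)) + (\<Sum>i=m..<m + n. fscale (?c i) (?d i))"
    using sum.atLeastLessThan_concat[of 0 m "m + n" "\<lambda>i. fscale (?c i) (?d i)"]
    by (simp add: atLeast0LessThan)
  also have "(\<Sum>i<m. fscale (?c i) (?d i)) = x"
    unfolding x by (intro sum.cong) auto
  also have "(\<Sum>i=m..<m + n. fscale (?c i) (?d i)) = y"
    unfolding y by (intro sum.reindex_bij_witness[of _ "\<lambda>i. i + m" "\<lambda>i. i - m"]) auto
  finally show ?thesis
    using x(2) y(2) unfolding n_term_def
    by (intro CollectI exI[of _ ?c] exI[of _ ?d]) auto
qed

lemma n_term_diff:
  assumes "x \<in> n_term m D" "y \<in> n_term n D" shows "x - y \<in> n_term (m + n) D"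
proof -
  obtain c d where y: "y = (\<Sum>i<n. fscale (c i) (d i))" "\<forall>i<n. d i \<in> D"
    using assms by (auto simp: n_term_def)
  have "- y = (\<Sum>i<n. fscale (- c i) (d i))"
    unfolding y sum_negf[symmetric] by (intro sum.cong) (auto simp: fscale_def)
  then have "- y \<in> n_term n D"
    using y(2) unfolding n_term_def by (intro CollectI exI[of _ "\<lambda>i. - c i"] exI[of _ d]) simp
  then show ?thesis
    using n_term_add[OF assms(1)] by fastforce
qed

lemma zero_in_n_term: "0 \<in> D \<Longrightarrow> 0 \<in> n_term n D"
  using n_term_mono[of 0 n D] by (auto simp: n_term_def)

text \<open>The abstract situation: \<open>Q\<close> is a common quasi-triangle constant of the two quasi-norms, \<open>J\<close> and \<open>B\<close>
  are the constants in the Jackson and Bernstein inequalities, both of order \<open>\<beta>\<close>. The inequalities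
  concern combinations of \<open>2\<^sup>n\<close> dictionary elements only, because the approximation quasi-norm
  samples the error at these numbers.\<close>

locale jackson_bernstein_pair =
  fixes X :: "('a \<Rightarrow> 'k::field) set" and NX NY :: "('a \<Rightarrow> 'k) \<Rightarrow> ennreal" and D :: "('a \<Rightarrow> 'k) set"
    and \<beta> Q J B :: real
  assumes zero_mem: "0 \<in> X"
    and diff_mem: "\<And>f g. f \<in> X \<Longrightarrow> g \<in> X \<Longrightarrow> f - g \<in> X"
    and NX_zero: "NX 0 = 0"
    and NX_minus_commute: "\<And>f g. NX (f - g) = NX (g - f)"
    and NX_triangle: "\<And>f g. f \<in> X \<Longrightarrow> g \<in> X \<Longrightarrow> NX (f + g) \<le> ennreal Q * (NX f + NX g)"
    and NX_finite: "\<And>f. f \<in> X \<Longrightarrow> NX f < \<infinity>"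
    and NY_triangle: "\<And>f g. f \<in> X \<Longrightarrow> g \<in> X \<Longrightarrow> NY (f + g) \<le> ennreal Q * (NY f + NY g)"
    and NX_le_NY: "\<And>f. NX f \<le> NY f"
    and zero_dict: "0 \<in> D"
    and n_term_mem: "\<And>n. n_term n D \<subseteq> X"
    and constants: "0 < \<beta>" "1 \<le> Q" "1 \<le> J" "1 \<le> B"
    and jackson: "\<And>g n. g \<in> X \<Longrightarrow> NY g < \<infinity> \<Longrightarrow>
      n_term_error NX D (2 ^ n) g \<le> ennreal (J * 2 powr (- real n * \<beta>)) * NY g"
    and bernstein: "\<And>g n. g \<in> n_term (2 ^ n) D \<Longrightarrow> NY g \<le> ennreal (B * 2 powr (real n * \<beta>)) * NX g"
begin

definition Y where "Y = {f \<in> X. NY f < \<infinity>}"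

lemma Y_mem: "g \<in> Y \<Longrightarrow> g \<in> X"
  by (simp add: Y_def)

lemma n_term_subset_Y: "n_term (2 ^ n) D \<subseteq> Y"
proof
  fix g assume g: "g \<in> n_term (2 ^ n) D"
  then have X: "g \<in> X"
    using n_term_mem by blast
  have "NY g \<le> ennreal (B * 2 powr (real n * \<beta>)) * NX g"
    using g by (rule bernstein)
  also have "\<dots> < \<infinity>"
    using NX_finite[OF X] by (simp add: ennreal_mult_less_top)
  finally show "g \<in> Y"
    using X by (simp add: Y_def)
qed

lemma NY_zero: "NY 0 = 0"
  using bernstein[of 0 0] zero_in_n_term[OF zero_dict] NX_zero by simp

lemma zero_mem_Y: "0 \<in> Y"
  by (simp add: Y_def zero_mem NY_zero)

lemma NX_dist_triangle:
  assumes "f \<in> X" "g \<in> X" "h \<in> X"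
  shows "NX (f - h) \<le> ennreal Q * (NX (f - g) + NX (g - h))"
  using NX_triangle[of "f - g" "g - h"] assms diff_mem by simp

abbreviation K where "K \<equiv> K_functional NX Y NY"

lemma K_le_NX: "K f t \<le> NX f"
  unfolding K_functional_def by (rule INF_lower2[of 0]) (auto simp: zero_mem_Y NY_zero)

text \<open>As \<open>NX\<close> is dominated by \<open>NY\<close>, the \<open>K\<close>-functional at \<open>1\<close> controls the full quasi-norm, and so the
  interpolation quasi-norm needs no separate term \<open>NX f\<close>.\<close>

lemma NX_le_K:
  assumes "f \<in> X" shows "NX f \<le> ennreal Q * K f 1"
proof -
  have "NX f \<le> ennreal Q * (0 + (INF g\<in>Y. NX (f - g) + ennreal 1 * NY g))"
  proof (rule le_cmult_add_INF)
    fix g assume g: "g \<in> Y"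
    have "NX f \<le> ennreal Q * (NX (f - g) + NX (g - 0))"
      using NX_dist_triangle[of f g 0] assms Y_mem[OF g] zero_mem by simp
    also have "\<dots> \<le> ennreal Q * (0 + (NX (f - g) + ennreal 1 * NY g))"
      using NX_le_NY[of g] by (intro mult_left_mono) (auto intro: add_left_mono)
    finally show "NX f \<le> ennreal Q * (0 + (NX (f - g) + ennreal 1 * NY g))" .
  qed (use zero_mem_Y in auto)
  then show ?thesis
    by (simp add: K_functional_def)
qed

text \<open>To approximate \<open>f\<close>, approximate a competitor \<open>g \<in> Y\<close> by means of the Jackson inequality and pay
  \<open>NX (f - g)\<close> for replacing \<open>f\<close> by \<open>g\<close>.\<close>

lemma n_term_error_le_K:
  assumes "f \<in> X"
  shows "n_term_error NX D (2 ^ n) f \<le> ennreal (Q * J) * K f (2 powr (- real n * \<beta>))"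
proof -
  have "n_term_error NX D (2 ^ n) f \<le> ennreal (Q * J) *
    (0 + (INF g\<in>Y. NX (f - g) + ennreal (2 powr (- real n * \<beta>)) * NY g))"
  proof (rule le_cmult_add_INF)
    fix g assume g: "g \<in> Y"
    have "n_term_error NX D (2 ^ n) f \<le> ennreal Q * (NX (f - g) + (INF y\<in>n_term (2 ^ n) D. NX (g - y)))"
    proof (rule le_cmult_add_INF)
      fix y assume y: "y \<in> n_term (2 ^ n) D"
      have "n_term_error NX D (2 ^ n) f \<le> NX (f - y)"
        unfolding n_term_error_def using y by (rule INF_lower)
      also have "\<dots> \<le> ennreal Q * (NX (f - g) + NX (g - y))"
        using y n_term_mem assms Y_mem[OF g] by (intro NX_dist_triangle) auto
      finally show "n_term_error NX D (2 ^ n) f \<le> ennreal Q * (NX (f - g) + NX (g - y))" .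
    qed (use zero_in_n_term[OF zero_dict] in auto)
    also have "(INF y\<in>n_term (2 ^ n) D. NX (g - y)) \<le> ennreal (J * 2 powr (- real n * \<beta>)) * NY g"
      using jackson[of g n] g by (simp add: Y_def n_term_error_def)
    also have "ennreal Q * (NX (f - g) + ennreal (J * 2 powr (- real n * \<beta>)) * NY g)
      \<le> ennreal Q * (ennreal J * NX (f - g) + ennreal J * (ennreal (2 powr (- real n * \<beta>)) * NY g))"
    proof (intro mult_left_mono add_mono)
      have "1 * NX (f - g) \<le> ennreal J * NX (f - g)"
        using constants by (intro mult_right_mono) auto
      then show "NX (f - g) \<le> ennreal J * NX (f - g)" by simp
    qed (use constants in \<open>auto simp: ennreal_mult mult.assoc\<close>)
    also have "\<dots> = ennreal (Q * J) * (0 + (NX (f - g) + ennreal (2 powr (- real n * \<beta>)) * NY g))"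
      using constants by (simp add: ennreal_mult mult.assoc distrib_left)
    finally show "n_term_error NX D (2 ^ n) f
      \<le> ennreal (Q * J) * (0 + (NX (f - g) + ennreal (2 powr (- real n * \<beta>)) * NY g))"
      by (simp add: mono_def mult_left_mono add_left_mono)
  qed (use zero_mem_Y in auto)
  then show ?thesis
    by (simp add: K_functional_def)
qed

lemma approx_dominated_by_interp:
  assumes "0 < q" "0 < \<alpha>"
  shows "dominated_on X (approx_norm NX D \<alpha> q) (interp_norm NX Y NY (\<alpha> / \<beta>) q)"
proof -
  let ?d = "\<lambda>f n. ennreal ((2 powr \<beta>) powr (real n * (\<alpha> / \<beta>))) * K f ((2 powr \<beta>) powr - real n)"
  have b: "2 powr \<beta> > 1" "\<alpha> / \<beta> > 0"
    using constants assms by auto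
  have discrete: "dominated_on X (\<lambda>f. lq_norm q (?d f)) (interp_norm NX Y NY (\<alpha> / \<beta>) q)"
    by (rule discrete_le_interp_norm[OF assms(1) b]) (rule dominated_onI)
  have "dominated_on X NX (\<lambda>f. lq_norm q (?d f))"
  proof (rule dominated_onI[of Q])
    fix f assume "f \<in> X"
    then have "NX f \<le> ennreal Q * ?d f 0"
      using NX_le_K by simp
    also have "\<dots> \<le> ennreal Q * lq_norm q (?d f)"
      using lq_norm_ge_nth[OF assms(1), of "?d f" 0] by (intro mult_left_mono) auto
    finally show "NX f \<le> ennreal Q * lq_norm q (?d f)" .
  qed (use constants in auto)
  moreover have "dominated_on X (\<lambda>f. lq_norm q (\<lambda>n. ennreal (2 powr (real n * \<alpha>)) * n_term_error NX D (2 ^ n) f))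
      (\<lambda>f. lq_norm q (?d f))"
  proof (rule dominated_onI[of "Q * J"])
    fix f assume f: "f \<in> X"
    have "lq_norm q (\<lambda>n. ennreal (2 powr (real n * \<alpha>)) * n_term_error NX D (2 ^ n) f)
      \<le> lq_norm q (\<lambda>n. ennreal (Q * J) * ?d f n)"
    proof (rule lq_norm_mono[OF assms(1)])
      fix n
      have "ennreal (2 powr (real n * \<alpha>)) * n_term_error NX D (2 ^ n) f
        \<le> ennreal (2 powr (real n * \<alpha>)) * (ennreal (Q * J) * K f (2 powr (- real n * \<beta>)))"
        using n_term_error_le_K[OF f] by (intro mult_left_mono) auto
      also have "\<dots> = ennreal (Q * J) * ?d f n"
        using constants by (simp add: powr_powr mult_ac)
      finally show "ennreal (2 powr (real n * \<alpha>)) * n_term_error NX D (2 ^ n) f \<le> ennreal (Q * J) * ?d f n" .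
    qed
    then show "lq_norm q (\<lambda>n. ennreal (2 powr (real n * \<alpha>)) * n_term_error NX D (2 ^ n) f)
      \<le> ennreal (Q * J) * lq_norm q (?d f)"
      by (simp only: lq_norm_cmult[OF assms(1)])
  qed (use constants in auto)
  ultimately have "dominated_on X (approx_norm NX D \<alpha> q) (\<lambda>f. lq_norm q (?d f))"
    unfolding approx_norm_def by (rule dominated_on_add)
  then show ?thesis
    using discrete by (rule dominated_on_trans)
qed

text \<open>What is known about \<open>NY g\<close> for an approximant \<open>g\<close> with \<open>2\<^bsup>L n\<^esup>\<close> terms comes from all coarser
  levels, discounted by a factor \<open>r\<close> per level. The sum is defined by recursion since it is
  only ever compared across one step.\<close>

primrec accumulated_error :: "nat \<Rightarrow> real \<Rightarrow> ('a \<Rightarrow> 'k) \<Rightarrow> nat \<Rightarrow> ennreal" where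
  "accumulated_error L r f 0 = NX f"
| "accumulated_error L r f (Suc n) =
    ennreal r * (accumulated_error L r f n + n_term_error NX D (2 ^ (L * n)) f)"

text \<open>Write \<open>g = (g - h) + h\<close> with \<open>h\<close> from the previous level: the Bernstein inequality bounds
  \<open>NY (g - h)\<close>, because \<open>g - h\<close> has at most \<open>2\<^bsup>L (n + 1) + 1\<^esup>\<close> terms, and the induction hypothesis bounds
  \<open>NY h\<close>. Each step costs a factor \<open>Q\<close>, whereas the Bernstein factor grows by \<open>b = 2\<^bsup>L \<beta>\<^esup>\<close>; the
  discount is therefore of order \<open>Q / b\<close>. With levels \<open>L\<close> apart, \<open>L\<close> large, the loss \<open>Q\<close> is harmless, and
  one does not have to pass to an equivalent \<open>r\<close>-norm (Aoki--Rolewicz).\<close>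

lemma NY_n_term_le_accumulated_error:
  fixes L :: nat
  defines "b \<equiv> 2 powr (real L * \<beta>)"
  defines "c \<equiv> Q\<^sup>2 * B * 2 powr \<beta> * b"
  assumes f: "f \<in> X" and g: "g \<in> n_term (2 ^ (L * n)) D"
  shows "NY g \<le> ennreal (c * b ^ n) * (NX (f - g) + accumulated_error L (2 * Q / b) f n)"
  using g
proof (induction n arbitrary: g)
  have b: "b \<ge> 1"
    using constants by (simp add: b_def ge_one_powr_ge_zero)
  have c: "c \<ge> B * Q"
  proof -
    have "B * Q * 1 * 1 \<le> (B * Q) * Q * (2 powr \<beta> * b)"
      using constants b ge_one_powr_ge_zero[of 2 \<beta>]
      using mult_mono[of 1 "2 powr \<beta>" 1 b] by (intro mult_mono) auto
    then show ?thesis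
      by (simp add: c_def power2_eq_square mult_ac)
  qed
  have pos: "0 < Q" "0 < B" "0 < b" "0 < c"
    using constants b c by (auto intro: less_le_trans[of _ "B * Q"])
  {
    case (0 g)
    then have g: "g \<in> n_term (2 ^ 0) D" by simp
    then have "g \<in> X"
      using n_term_mem by blast
    have "NY g \<le> ennreal B * NX g"
      using bernstein[OF g] by simp
    also have "\<dots> \<le> ennreal B * (ennreal Q * (NX (g - f) + NX (f - 0)))"
      using NX_dist_triangle[of g f 0] \<open>g \<in> X\<close> f zero_mem by (intro mult_left_mono) auto
    also have "\<dots> = ennreal (B * Q) * (NX (f - g) + NX f)"
      using pos by (simp add: NX_minus_commute[of g f] ennreal_mult mult.assoc)
    also have "\<dots> \<le> ennreal c * (NX (f - g) + NX f)"
      using c by (intro mult_right_mono ennreal_leI) auto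
    finally show ?case by (simp add: fun_diff_def)
  next
    case (Suc n g)
    let ?w = "accumulated_error L (2 * Q / b) f n"
    have gX: "g \<in> X"
      using Suc.prems n_term_mem by blast
    have "NY g \<le> (ennreal (c * b ^ Suc n) * NX (f - g) + ennreal (2 * Q * c * b ^ n) * ?w)
      + ennreal (2 * Q * c * b ^ n) * (INF h\<in>n_term (2 ^ (L * n)) D. NX (f - h))"
    proof (rule le_affine_INF)
      fix h assume h: "h \<in> n_term (2 ^ (L * n)) D"
      then have hX: "h \<in> X"
        using n_term_mem by blast
      have "(2::nat) ^ (L * n) \<le> 2 ^ (L * Suc n)"
        by (intro power_increasing) auto
      then have "(2::nat) ^ (L * Suc n) + 2 ^ (L * n) \<le> 2 ^ Suc (L * Suc n)"
        by simp
      then have "g - h \<in> n_term (2 ^ Suc (L * Suc n)) D"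
        using n_term_diff[OF Suc.prems h] n_term_mono[OF _ zero_dict] by blast
      then have "NY (g - h) \<le> ennreal (B * 2 powr (real (Suc (L * Suc n)) * \<beta>)) * NX (g - h)"
        by (rule bernstein)
      also have "2 powr (real (Suc (L * Suc n)) * \<beta>) = 2 powr \<beta> * b ^ Suc n"
        unfolding b_def by (subst powr_power) (auto simp: powr_add[symmetric] algebra_simps)
      also have "ennreal (B * (2 powr \<beta> * b ^ Suc n)) * NX (g - h)
        \<le> ennreal (B * (2 powr \<beta> * b ^ Suc n)) * (ennreal Q * (NX (f - g) + NX (f - h)))"
        using NX_dist_triangle[OF gX f hX] by (intro mult_left_mono) (auto simp: NX_minus_commute[of g f])
      finally have gh: "NY (g - h) \<le> ennreal (B * (2 powr \<beta> * b ^ Suc n)) * (ennreal Q * (NX (f - g) + NX (f - h)))" .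
      have "NY g \<le> ennreal Q * (NY (g - h) + NY h)"
        using NY_triangle[of "g - h" h] diff_mem gX hX by simp
      also have "\<dots> \<le> ennreal Q * (ennreal (B * (2 powr \<beta> * b ^ Suc n)) * (ennreal Q * (NX (f - g) + NX (f - h)))
          + ennreal (c * b ^ n) * (NX (f - h) + ?w))"
        using Suc.IH[OF h] by (intro mult_left_mono add_mono gh) (auto simp: fun_diff_def)
      also have "\<dots> = ennreal (Q * (B * (2 powr \<beta> * b ^ Suc n)) * Q) * (NX (f - g) + NX (f - h))
          + ennreal (Q * c * b ^ n) * (NX (f - h) + ?w)"
        using pos by (simp only: ennreal_mult distrib_left mult.assoc) (simp add: ennreal_mult mult_ac distrib_left)
      also have "Q * (B * (2 powr \<beta> * b ^ Suc n)) * Q = c * b ^ n"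
        by (simp add: c_def power2_eq_square)
      also have "ennreal (c * b ^ n) * (NX (f - g) + NX (f - h)) + ennreal (Q * c * b ^ n) * (NX (f - h) + ?w)
        = ennreal (c * b ^ n) * NX (f - g) + ennreal (Q * c * b ^ n) * ?w
          + (ennreal (c * b ^ n) + ennreal (Q * c * b ^ n)) * NX (f - h)"
        by (simp add: distrib_left distrib_right ac_simps)
      also have "\<dots> \<le> ennreal (c * b ^ Suc n) * NX (f - g) + ennreal (2 * Q * c * b ^ n) * ?w
          + ennreal (2 * Q * c * b ^ n) * NX (f - h)"
      proof (intro add_mono mult_right_mono)
        show "ennreal (c * b ^ n) \<le> ennreal (c * b ^ Suc n)"
          using b pos by (intro ennreal_leI mult_left_mono power_increasing) auto
        show "ennreal (Q * c * b ^ n) \<le> ennreal (2 * Q * c * b ^ n)"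
          using pos by (intro ennreal_leI mult_right_mono) auto
        have "1 * (c * b ^ n) \<le> Q * (c * b ^ n)"
          using constants pos by (intro mult_right_mono) auto
        then have "ennreal (c * b ^ n + Q * c * b ^ n) \<le> ennreal (2 * Q * c * b ^ n)"
          by (intro ennreal_leI) simp
        then show "ennreal (c * b ^ n) + ennreal (Q * c * b ^ n) \<le> ennreal (2 * Q * c * b ^ n)"
          using pos by (subst (asm) ennreal_plus) simp_all
      qed auto
      finally show "NY g \<le> ennreal (c * b ^ Suc n) * NX (f - g) + ennreal (2 * Q * c * b ^ n) * ?w
          + ennreal (2 * Q * c * b ^ n) * NX (f - h)" .
    qed (use zero_in_n_term[OF zero_dict] in auto)
    also have "2 * Q * c * b ^ n = c * b ^ Suc n * (2 * Q / b)"
      using pos by simp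
    also have "ennreal (c * b ^ Suc n * (2 * Q / b)) = ennreal (c * b ^ Suc n) * ennreal (2 * Q / b)"
      using pos by (intro ennreal_mult') simp
    finally show ?case
      by (simp add: n_term_error_def distrib_left add.assoc mult.assoc fun_diff_def del: power_Suc)
  }
qed

text \<open>An approximant with \<open>2\<^bsup>L n\<^esup>\<close> terms is the competitor in the \<open>K\<close>-functional at \<open>2\<^bsup>- L n \<beta>\<^esup>\<close>. In
  the weighted sequence space the discount becomes \<open>2 Q 2\<^bsup>- L (\<beta> - \<alpha>)\<^esup>\<close>, which is at most \<open>1/4\<close> for
  large \<open>L\<close> because \<open>\<alpha> < \<beta>\<close>; the discrete Hardy inequality then sums the errors of all levels.\<close>

lemma interp_dominated_by_approx:
  assumes "0 < q" "0 < \<alpha>" "\<alpha> < \<beta>"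
  shows "dominated_on X (interp_norm NX Y NY (\<alpha> / \<beta>) q) (approx_norm NX D \<alpha> q)"
proof -
  obtain L :: nat where L: "L \<ge> 1" "2 * Q * 2 powr (- real L * (\<beta> - \<alpha>)) \<le> 1 / 4"
  proof -
    obtain m :: nat where m: "log 2 (8 * Q) / (\<beta> - \<alpha>) \<le> real m"
      using real_arch_simple by blast
    have "log 2 (8 * Q) \<le> real (Suc m) * (\<beta> - \<alpha>)"
      using m assms by (simp add: divide_le_eq algebra_simps)
    then have "8 * Q \<le> 2 powr (real (Suc m) * (\<beta> - \<alpha>))"
      using constants by (simp add: log_le_iff del: of_nat_Suc)
    then have "2 * Q * 2 powr (- real (Suc m) * (\<beta> - \<alpha>)) \<le> 1 / 4"
      by (simp add: powr_minus_divide divide_le_eq del: of_nat_Suc)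
    then show thesis
      by (intro that[of "Suc m"]) auto
  qed
  define b where "b = 2 powr (real L * \<beta>)"
  define c where "c = Q\<^sup>2 * B * 2 powr \<beta> * b"
  define \<theta> where "\<theta> = \<alpha> / \<beta>"
  have b: "1 < b" "0 < \<theta>" and b_\<theta>: "b powr (real n * \<theta>) = 2 powr (real (L * n) * \<alpha>)" for n
    using constants assms L by (auto simp: b_def \<theta>_def powr_powr mult_ac)
  have c: "c > 0"
    using constants b by (auto simp: c_def)
  let ?w = "accumulated_error L (2 * Q / b)"
  let ?a = "\<lambda>f n. ennreal (2 powr (real n * \<alpha>)) * n_term_error NX D (2 ^ n) f"
  let ?u = "\<lambda>f n. ?a f (L * n)"
  let ?v = "\<lambda>f n. ennreal (b powr (real n * \<theta>)) * ?w f n"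
  let ?d = "\<lambda>f n. ennreal (b powr (real n * \<theta>)) * K f (b powr - real n)"
  have d_le: "?d f n \<le> ennreal (1 + c) * (?v f n + ?u f n)" if f: "f \<in> X" for f n
  proof -
    have "K f (b powr - real n) \<le> ennreal (1 + c) * (?w f n + (INF g\<in>n_term (2 ^ (L * n)) D. NX (f - g)))"
    proof (rule le_cmult_add_INF)
      fix g assume g: "g \<in> n_term (2 ^ (L * n)) D"
      have "K f (b powr - real n) \<le> NX (f - g) + ennreal (b powr - real n) * NY g"
        unfolding K_functional_def using g n_term_subset_Y by (intro INF_lower) auto
      also have "\<dots> \<le> NX (f - g) + ennreal (b powr - real n) * (ennreal (c * b ^ n) * (NX (f - g) + ?w f n))"
        using NY_n_term_le_accumulated_error[OF f g]
        by (intro add_left_mono mult_left_mono) (auto simp: b_def c_def)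
      also have "\<dots> = NX (f - g) + ennreal (b powr - real n * (c * b ^ n)) * (NX (f - g) + ?w f n)"
        by (simp only: ennreal_mult' powr_ge_zero mult.assoc)
      also have "b powr - real n * (c * b ^ n) = c"
        using b by (simp add: powr_minus powr_realpow)
      also have "NX (f - g) + ennreal c * (NX (f - g) + ?w f n)
          \<le> (?w f n + NX (f - g)) + ennreal c * (?w f n + NX (f - g))"
        unfolding add.commute[of "NX (f - g)" "?w f n"] by (intro add_right_mono) simp
      also have "\<dots> = ennreal (1 + c) * (?w f n + NX (f - g))"
        using c by (simp add: distrib_right)
      finally show "K f (b powr - real n) \<le> ennreal (1 + c) * (?w f n + NX (f - g))" .
    qed (use zero_in_n_term[OF zero_dict] in auto)
    then have "?d f n \<le> ennreal (b powr (real n * \<theta>)) *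
        (ennreal (1 + c) * (?w f n + n_term_error NX D (2 ^ (L * n)) f))"
      unfolding n_term_error_def by (intro mult_left_mono) auto
    then show ?thesis
      unfolding b_\<theta>[symmetric] by (simp add: distrib_left mult_ac)
  qed
  have v_rec: "?v f (Suc n) \<le> ennreal (1 / 4) * (?v f n + ?u f n)" for f n
  proof -
    have "b powr (real (Suc n) * \<theta>) * (2 * Q / b) = 2 * Q * 2 powr (- real L * (\<beta> - \<alpha>)) * b powr (real n * \<theta>)"
      unfolding b_\<theta> by (simp add: b_def powr_minus_divide powr_add powr_diff algebra_simps)
    also have "\<dots> \<le> 1 / 4 * b powr (real n * \<theta>)"
      by (intro mult_right_mono L) auto
    finally have "?v f (Suc n) \<le> ennreal (1 / 4 * b powr (real n * \<theta>)) * (?w f n + n_term_error NX D (2 ^ (L * n)) f)"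
      using constants b by (auto simp: mult.assoc[symmetric] simp flip: ennreal_mult intro!: mult_right_mono ennreal_leI)
    then show ?thesis
      by (simp only: b_\<theta> ennreal_mult' distrib_left mult.assoc)
  qed
  obtain C0 where C0: "0 < C0" "\<And>u v. (\<And>n. v (Suc n) \<le> ennreal (1 / 4) * (v n + u n)) \<Longrightarrow>
      lq_norm q v \<le> ennreal C0 * (v 0 + lq_norm q u)"
    using lq_norm_contractive_recursion[OF assms(1)] by blast
  obtain C1 where C1: "0 < C1" "\<And>u v. lq_norm q (\<lambda>n. u n + v n) \<le> ennreal C1 * (lq_norm q u + lq_norm q v)"
    using lq_norm_add_le[OF assms(1)] by blast
  have N: "dominated_on X NX (approx_norm NX D \<alpha> q)"
    by (intro dominated_on_le) (auto simp: approx_norm_def)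
  have u: "dominated_on X (\<lambda>f. lq_norm q (?u f)) (approx_norm NX D \<alpha> q)"
  proof (rule dominated_on_le)
    fix f
    have "strict_mono (\<lambda>n. L * n)"
      using L by (auto simp: strict_mono_def)
    then have "lq_norm q (?u f) \<le> lq_norm q (?a f)"
      by (rule lq_norm_subsequence[OF assms(1)])
    then show "lq_norm q (?u f) \<le> approx_norm NX D \<alpha> q f"
      unfolding approx_norm_def by (rule add_increasing[OF zero_le])
  qed
  have "dominated_on X (\<lambda>f. lq_norm q (?v f)) (\<lambda>f. NX f + lq_norm q (?u f))"
    using C0(2)[of "?v f" "?u f" for f, OF v_rec] b(1) by (intro dominated_onI[OF C0(1)]) simp
  also have "dominated_on X \<dots> (approx_norm NX D \<alpha> q)"
    by (intro dominated_on_add N u)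
  finally have v: "dominated_on X (\<lambda>f. lq_norm q (?v f)) (approx_norm NX D \<alpha> q)" .
  have "dominated_on X (\<lambda>f. lq_norm q (?d f)) (\<lambda>f. lq_norm q (\<lambda>n. ?v f n + ?u f n))"
  proof (rule dominated_onI[of "1 + c"])
    fix f assume "f \<in> X"
    then show "lq_norm q (?d f) \<le> ennreal (1 + c) * lq_norm q (\<lambda>n. ?v f n + ?u f n)"
      using lq_norm_mono[OF assms(1), of "?d f" "\<lambda>n. ennreal (1 + c) * (?v f n + ?u f n)"] d_le
      by (simp only: lq_norm_cmult[OF assms(1)])
  qed (use c in auto)
  also have "dominated_on X \<dots> (\<lambda>f. lq_norm q (?v f) + lq_norm q (?u f))"
    by (intro dominated_onI[OF C1(1)] C1(2))
  also have "dominated_on X \<dots> (approx_norm NX D \<alpha> q)"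
    by (intro dominated_on_add v u)
  finally have d: "dominated_on X (\<lambda>f. lq_norm q (?d f)) (approx_norm NX D \<alpha> q)" .
  have "dominated_on X (interp_norm NX Y NY \<theta> q) (\<lambda>f. NX f + lq_norm q (?d f))"
  proof (rule interp_norm_le_discrete[OF assms(1) b])
    fix C :: real
    assume C: "0 < C" and bound: "\<And>NX Y NY (f :: 'a \<Rightarrow> 'k). (\<And>t. K_functional NX Y NY f t \<le> NX f) \<Longrightarrow>
      interp_norm NX Y NY \<theta> q f \<le> ennreal C *
        (NX f + lq_norm q (\<lambda>n. ennreal (b powr (real n * \<theta>)) * K_functional NX Y NY f (b powr - real n)))"
    show "dominated_on X (interp_norm NX Y NY \<theta> q) (\<lambda>f. NX f + lq_norm q (?d f))"
      by (rule dominated_onI[OF C]) (rule bound[OF K_le_NX])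
  qed
  also have "dominated_on X \<dots> (approx_norm NX D \<alpha> q)"
    by (intro dominated_on_add N d)
  finally show ?thesis
    by (simp add: \<theta>_def)
qed

theorem approx_space_eq_interp_space:
  assumes "0 < q" "0 < \<alpha>" "\<alpha> < \<beta>"
  shows "approx_space X NX D \<alpha> q = interp_space X NX Y NY (\<alpha> / \<beta>) q"
    and "equivalent_on (approx_space X NX D \<alpha> q) (approx_norm NX D \<alpha> q) (interp_norm NX Y NY (\<alpha> / \<beta>) q)"
proof -
  note AI = approx_dominated_by_interp[OF assms(1,2)] and IA = interp_dominated_by_approx[OF assms]
  show "approx_space X NX D \<alpha> q = interp_space X NX Y NY (\<alpha> / \<beta>) q"
    using dominated_on_finite[OF AI] dominated_on_finite[OF IA]
    by (auto simp: approx_space_def interp_space_def)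
  show "equivalent_on (approx_space X NX D \<alpha> q) (approx_norm NX D \<alpha> q) (interp_norm NX Y NY (\<alpha> / \<beta>) q)"
    by (intro equivalent_onI dominated_on_subset[OF AI] dominated_on_subset[OF IA])
      (auto simp: approx_space_def)
qed

end

section \<open>Quasi-norms of \<open>L\<^sup>p\<close> type\<close>

lemma ennpowr_Lp_norm_on:
  "p > 0 \<Longrightarrow> ennpowr (Lp_norm_on M p R f) p = (\<integral>\<^sup>+\<omega>\<in>R. ennreal (norm (f \<omega>) powr p) \<partial>M)"
  by (simp add: Lp_norm_on_def)

lemma Lp_norm_on_le_iff:
  "p > 0 \<Longrightarrow> Lp_norm_on M p R f \<le> c \<longleftrightarrow> (\<integral>\<^sup>+\<omega>\<in>R. ennreal (norm (f \<omega>) powr p) \<partial>M) \<le> ennpowr c p"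
  by (simp add: Lp_norm_on_def ennpowr_root_le_iff)

lemma Lp_norm_on_cong:
  "(\<And>\<omega>. \<omega> \<in> R \<Longrightarrow> norm (f \<omega>) = norm (g \<omega>)) \<Longrightarrow> Lp_norm_on M p R f = Lp_norm_on M p R g"
  unfolding Lp_norm_on_def
  by (intro arg_cong2[where f = ennpowr] nn_integral_cong) (auto simp: indicator_def)

lemma Lp_norm_on_zero [simp]: "Lp_norm_on M p R 0 = 0"
  by (simp add: Lp_norm_on_def)

lemma Lp_norm_on_minus_commute: "Lp_norm_on M p R (f - g) = Lp_norm_on M p R (g - f)"
  by (intro Lp_norm_on_cong) (simp add: norm_minus_commute)

lemma Lp_norm_on_mono_set:
  assumes "p > 0" "R \<subseteq> R'" shows "Lp_norm_on M p R f \<le> Lp_norm_on M p R' f"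
  using assms unfolding Lp_norm_on_def
  by (intro ennpowr_mono nn_integral_mono) (auto simp: indicator_def)

definition Lp_quasi_constant :: "real \<Rightarrow> real" where
  "Lp_quasi_constant p = 2 * 2 powr (1 / p)"

lemma Lp_quasi_constant_ge_1: "p > 0 \<Longrightarrow> Lp_quasi_constant p \<ge> 1"
  using ge_one_powr_ge_zero[of 2 "1 / p"] by (simp add: Lp_quasi_constant_def)

lemma Lp_norm_on_triangle:
  fixes f g :: "'a \<Rightarrow> 'k::{real_normed_field,euclidean_space}"
  assumes "p > 0" "R \<in> sets M" and [measurable]: "f \<in> borel_measurable M" "g \<in> borel_measurable M"
  shows "Lp_norm_on M p R (f + g) \<le> ennreal (Lp_quasi_constant p) * (Lp_norm_on M p R f + Lp_norm_on M p R g)"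
proof -
  note [measurable] = assms(2)
  have "ennreal (norm ((f + g) \<omega>) powr p)
      \<le> ennreal (2 powr p) * (ennreal (norm (f \<omega>) powr p) + ennreal (norm (g \<omega>) powr p))" for \<omega>
  proof -
    have "ennreal (norm ((f + g) \<omega>) powr p) = ennpowr (ennreal (norm ((f + g) \<omega>))) p"
      by (simp add: ennpowr_ennreal)
    also have "\<dots> \<le> ennpowr (ennreal (norm (f \<omega>)) + ennreal (norm (g \<omega>))) p"
      using assms(1) norm_triangle_ineq[of "f \<omega>" "g \<omega>"]
      by (intro ennpowr_mono) (auto simp flip: ennreal_plus intro: ennreal_leI)
    also have "\<dots> \<le> ennreal (2 powr p) * (ennpowr (ennreal (norm (f \<omega>))) p + ennpowr (ennreal (norm (g \<omega>))) p)"
      using assms(1) by (rule ennpowr_add_le)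
    finally show ?thesis
      by (simp add: ennpowr_ennreal)
  qed
  then have "(\<integral>\<^sup>+\<omega>\<in>R. ennreal (norm ((f + g) \<omega>) powr p) \<partial>M)
      \<le> (\<integral>\<^sup>+\<omega>. ennreal (2 powr p) * (ennreal (norm (f \<omega>) powr p) * indicator R \<omega>
          + ennreal (norm (g \<omega>) powr p) * indicator R \<omega>) \<partial>M)"
    by (intro nn_integral_mono) (auto simp: indicator_def)
  also have "\<dots> = ennreal (2 powr p) * ((\<integral>\<^sup>+\<omega>\<in>R. ennreal (norm (f \<omega>) powr p) \<partial>M)
      + (\<integral>\<^sup>+\<omega>\<in>R. ennreal (norm (g \<omega>) powr p) \<partial>M))"
    by (simp add: nn_integral_cmult nn_integral_add)
  finally have "Lp_norm_on M p R (f + g) \<le> ennpowr (ennreal (2 powr p) *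
      ((\<integral>\<^sup>+\<omega>\<in>R. ennreal (norm (f \<omega>) powr p) \<partial>M) + (\<integral>\<^sup>+\<omega>\<in>R. ennreal (norm (g \<omega>) powr p) \<partial>M))) (1 / p)"
    unfolding Lp_norm_on_def using assms(1) by (intro ennpowr_mono) auto
  also have "\<dots> = ennreal 2 *
      ennpowr ((\<integral>\<^sup>+\<omega>\<in>R. ennreal (norm (f \<omega>) powr p) \<partial>M) + (\<integral>\<^sup>+\<omega>\<in>R. ennreal (norm (g \<omega>) powr p) \<partial>M)) (1 / p)"
    using assms(1) by (simp add: ennpowr_mult ennpowr_ennreal powr_powr)
  also have "\<dots> \<le> ennreal 2 * (ennreal (2 powr (1 / p)) * (Lp_norm_on M p R f + Lp_norm_on M p R g))"
    unfolding Lp_norm_on_def using assms(1) by (intro mult_left_mono ennpowr_add_le) auto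
  finally show ?thesis
    by (simp add: Lp_quasi_constant_def ennreal_mult' mult.assoc)
qed

text \<open>The \<open>p\<close>-th powers of local \<open>L\<^sup>p\<close> norms are additive over disjoint sets.\<close>

lemma sum_Lp_norm_on_powr_le:
  fixes f :: "'a \<Rightarrow> 'k::{real_normed_field,euclidean_space}"
  assumes "p > 0" "finite \<R>" "disjoint \<R>" "\<R> \<subseteq> sets M" and [measurable]: "f \<in> borel_measurable M"
  shows "(\<Sum>R\<in>\<R>. ennpowr (Lp_norm_on M p R f) p) \<le> ennpowr (Lp_norm M p f) p"
proof -
  have [measurable]: "R \<in> sets M" if "R \<in> \<R>" for R
    using that assms by auto
  have "(\<Sum>R\<in>\<R>. ennpowr (Lp_norm_on M p R f) p)
      = (\<integral>\<^sup>+\<omega>. (\<Sum>R\<in>\<R>. ennreal (norm (f \<omega>) powr p) * indicator R \<omega>) \<partial>M)"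
    using assms(1) by (subst nn_integral_sum) (auto simp: ennpowr_Lp_norm_on)
  also have "\<dots> = (\<integral>\<^sup>+\<omega>. ennreal (norm (f \<omega>) powr p) * indicator (\<Union>\<R>) \<omega> \<partial>M)"
  proof (intro nn_integral_cong)
    fix \<omega>
    have "(\<Sum>R\<in>\<R>. indicator R \<omega>) = (indicator (\<Union>R\<in>\<R>. R) \<omega> :: ennreal)"
      using assms by (intro indicator_UN_disjoint[symmetric])
        (auto simp: disjoint_family_on_def disjoint_def)
    then show "(\<Sum>R\<in>\<R>. ennreal (norm (f \<omega>) powr p) * indicator R \<omega>)
        = ennreal (norm (f \<omega>) powr p) * indicator (\<Union>\<R>) \<omega>"
      by (simp add: sum_distrib_left[symmetric])
  qed
  also have "\<dots> \<le> ennpowr (Lp_norm M p f) p"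
    unfolding ennpowr_Lp_norm_on[OF assms(1)]
    by (intro nn_integral_mono) (auto simp: indicator_def)
  finally show ?thesis .
qed

section \<open>Local errors and variation\<close>

text \<open>The cut-off in the definition of the local error is invisible to the norm on \<open>R\<close>.\<close>

lemma local_error_eq: "local_error M S p f R = (INF h\<in>S. Lp_norm_on M p R (f - h))"
proof -
  have "Lp_norm_on M p R (f - cut h R) = Lp_norm_on M p R (f - h)" for h
    by (intro Lp_norm_on_cong) (simp add: cut_def)
  moreover have "{cut h R |h. h \<in> S} = (\<lambda>h. cut h R) ` S"
    by auto
  ultimately show ?thesis
    by (simp add: local_error_def image_comp)
qed

lemma local_error_le: "h \<in> S \<Longrightarrow> local_error M S p f R \<le> Lp_norm_on M p R (f - h)"
  by (auto simp: local_error_eq intro: INF_lower)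

lemma local_error_triangle:
  assumes "p > 0" "R \<in> sets M" "scalar_fun.subspace S" "S \<subseteq> borel_measurable M"
    and "f \<in> borel_measurable M" "g \<in> borel_measurable M"
  shows "local_error M S p (f + g) R \<le> ennreal (Lp_quasi_constant p) * (local_error M S p f R + local_error M S p g R)"
proof -
  have ne: "S \<noteq> {}"
    using scalar_fun.subspace_0[OF assms(3)] by auto
  have "local_error M S p (f + g) R \<le> ennreal (Lp_quasi_constant p) * (local_error M S p f R + (INF h\<in>S. Lp_norm_on M p R (g - h)))"
  proof (rule le_cmult_add_INF[OF ne])
    fix h assume h: "h \<in> S"
    have "local_error M S p (f + g) R \<le>
        ennreal (Lp_quasi_constant p) * (Lp_norm_on M p R (g - h) + (INF h\<in>S. Lp_norm_on M p R (f - h)))"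
    proof (rule le_cmult_add_INF[OF ne])
      fix h' assume h': "h' \<in> S"
      have "local_error M S p (f + g) R \<le> Lp_norm_on M p R ((f + g) - (h + h'))"
        using h h' assms(3) by (intro local_error_le scalar_fun.subspace_add)
      also have "(f + g) - (h + h') = (g - h) + (f - h')"
        by (simp add: algebra_simps)
      also have "Lp_norm_on M p R \<dots>
          \<le> ennreal (Lp_quasi_constant p) * (Lp_norm_on M p R (g - h) + Lp_norm_on M p R (f - h'))"
        using assms h h' unfolding fun_diff_def
        by (intro Lp_norm_on_triangle borel_measurable_diff) auto
      finally show "local_error M S p (f + g) R
          \<le> ennreal (Lp_quasi_constant p) * (Lp_norm_on M p R (g - h) + Lp_norm_on M p R (f - h'))" .
    qed
    then show "local_error M S p (f + g) R \<le>
        ennreal (Lp_quasi_constant p) * (local_error M S p f R + Lp_norm_on M p R (g - h))"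
      by (simp add: local_error_eq add.commute)
  qed
  then show ?thesis
    by (simp add: local_error_eq)
qed

lemma variation_ge:
  assumes "\<sigma> > 0" "finite \<R>" "\<R> \<subseteq> atoms F \<union> rings F" "disjoint \<R>"
  shows "(\<Sum>R\<in>\<R>. ennpowr (local_error M S p f R) \<sigma>) \<le> ennpowr (variation M F S \<sigma> p f) \<sigma>"
  unfolding ennpowr_root_le_iff[OF assms(1), symmetric] variation_def
  using assms by (intro SUP_upper) auto

lemma variation_leI:
  assumes "\<sigma> > 0"
    and "\<And>\<R>. finite \<R> \<Longrightarrow> \<R> \<subseteq> atoms F \<union> rings F \<Longrightarrow> disjoint \<R> \<Longrightarrow>
      (\<Sum>R\<in>\<R>. ennpowr (local_error M S p f R) \<sigma>) \<le> ennpowr c \<sigma>"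
  shows "variation M F S \<sigma> p f \<le> c"
  unfolding variation_def using assms by (intro SUP_least) (auto simp: ennpowr_root_le_iff)

lemma variation_triangle:
  assumes "p > 0" "\<sigma> > 0" "atoms F \<union> rings F \<subseteq> sets M" "scalar_fun.subspace S" "S \<subseteq> borel_measurable M"
    and "f \<in> borel_measurable M" "g \<in> borel_measurable M"
  shows "variation M F S \<sigma> p (f + g) \<le> ennreal (Lp_quasi_constant p * Lp_quasi_constant \<sigma>) *
      (variation M F S \<sigma> p f + variation M F S \<sigma> p g)"
proof -
  let ?E = "\<lambda>f R. ennpowr (local_error M S p f R) \<sigma>" and ?V = "\<lambda>f. variation M F S \<sigma> p f"
  let ?C = "Lp_quasi_constant p"
  have C: "?C > 0"
    using Lp_quasi_constant_ge_1[OF assms(1)] by simp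
  show ?thesis
  proof (rule variation_leI[OF assms(2)])
    fix \<R> assume \<R>: "finite \<R>" "\<R> \<subseteq> atoms F \<union> rings F" "disjoint \<R>"
    have "?E (f + g) R \<le> ennreal (?C powr \<sigma> * 2 powr \<sigma>) * (?E f R + ?E g R)" if "R \<in> \<R>" for R
    proof -
      have "?E (f + g) R \<le> ennpowr (ennreal ?C * (local_error M S p f R + local_error M S p g R)) \<sigma>"
        using that \<R> assms by (intro ennpowr_mono local_error_triangle) auto
      also have "\<dots> = ennreal (?C powr \<sigma>) * ennpowr (local_error M S p f R + local_error M S p g R) \<sigma>"
        using assms C by (simp add: ennpowr_mult ennpowr_ennreal)
      also have "\<dots> \<le> ennreal (?C powr \<sigma>) * (ennreal (2 powr \<sigma>) * (?E f R + ?E g R))"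
        using assms by (intro mult_left_mono ennpowr_add_le) auto
      finally show ?thesis
        by (simp add: ennreal_mult mult.assoc)
    qed
    then have "(\<Sum>R\<in>\<R>. ?E (f + g) R) \<le> (\<Sum>R\<in>\<R>. ennreal (?C powr \<sigma> * 2 powr \<sigma>) * (?E f R + ?E g R))"
      by (rule sum_mono)
    also have "\<dots> = ennreal (?C powr \<sigma> * 2 powr \<sigma>) * ((\<Sum>R\<in>\<R>. ?E f R) + (\<Sum>R\<in>\<R>. ?E g R))"
      by (simp add: sum_distrib_left[symmetric] sum.distrib)
    also have "\<dots> \<le> ennreal (?C powr \<sigma> * 2 powr \<sigma>) * (ennpowr (?V f + ?V g) \<sigma> + ennpowr (?V f + ?V g) \<sigma>)"
    proof (intro mult_left_mono add_mono)
      show "(\<Sum>R\<in>\<R>. ?E f R) \<le> ennpowr (?V f + ?V g) \<sigma>"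
        by (rule order_trans[OF variation_ge ennpowr_mono]) (use assms \<R> in auto)
      show "(\<Sum>R\<in>\<R>. ?E g R) \<le> ennpowr (?V f + ?V g) \<sigma>"
        by (rule order_trans[OF variation_ge ennpowr_mono]) (use assms \<R> in auto)
    qed auto
    also have "\<dots> = ennreal (?C powr \<sigma> * 2 powr \<sigma> * 2) * ennpowr (?V f + ?V g) \<sigma>"
      by (simp add: mult_2[symmetric] ennreal_mult mult.assoc)
    also have "?C powr \<sigma> * 2 powr \<sigma> * 2 = (?C * Lp_quasi_constant \<sigma>) powr \<sigma>"
      using assms C powr_mult[of 2 2 \<sigma>] by (simp add: Lp_quasi_constant_def powr_mult powr_powr)
    also have "ennreal ((?C * Lp_quasi_constant \<sigma>) powr \<sigma>) * ennpowr (?V f + ?V g) \<sigma>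
        = ennpowr (ennreal (?C * Lp_quasi_constant \<sigma>) * (?V f + ?V g)) \<sigma>"
      using assms C by (simp add: ennpowr_mult ennpowr_ennreal Lp_quasi_constant_def)
    finally show "(\<Sum>R\<in>\<R>. ?E (f + g) R) \<le> ennpowr (ennreal (?C * Lp_quasi_constant \<sigma>) * (?V f + ?V g)) \<sigma>" .
  qed
qed

section \<open>The tree of atoms\<close>

lemma atoms_of_eq_or_disjoint:
  assumes "\<And>A B. A \<in> \<A> \<Longrightarrow> B \<in> \<A> \<Longrightarrow> A \<inter> B \<in> \<A>" "A \<in> atoms_of \<A>" "B \<in> \<A>"
  shows "A \<subseteq> B \<or> A \<inter> B = {}"
proof -
  have "A \<inter> B \<in> \<A>" "A \<inter> B \<subseteq> A"
    using assms by (auto simp: atoms_of_def)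
  then have "A \<inter> B = {} \<or> A \<inter> B = A"
    using assms(2) by (auto simp: atoms_of_def)
  then show ?thesis by blast
qed

text \<open>Here \<open>C\<close> is the atom on which a dictionary element lives, and \<open>A - B\<close> an atom (\<open>B = {}\<close>) or a ring. As
  atoms are nested or disjoint, \<open>C\<close> contains \<open>A - B\<close> or is disjoint from it if it does not split it.\<close>

definition splits :: "'a set \<Rightarrow> 'a set \<Rightarrow> 'a set \<Rightarrow> bool" where
  "splits C A B \<longleftrightarrow> C \<subset> A \<and> \<not> C \<subseteq> B"

lemma atom_or_ring_cases:
  assumes "R \<in> atoms F \<union> rings F"
  obtains A B where "R = A - B" "A \<in> atoms F" "B \<in> insert {} (atoms F)"
proof (cases "R \<in> atoms F")
  case True
  then show thesis
    by (intro that[of R "{}"]) auto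
next
  case False
  then obtain A B where "R = A - B" "A \<in> atoms F" "B \<in> atoms F"
    using assms by (auto simp: rings_def)
  then show thesis
    by (intro that[of A B]) auto
qed

locale atomic_filtration = prob_space M for M :: "'a measure" +
  fixes \<nu> :: nat and F :: "nat \<Rightarrow> 'a set set"
  assumes filtration: "nary_filtration M \<nu> F"
begin

lemma sigma_algebra_level: "sigma_algebra (space M) (F n)"
  and finite_level: "finite (F n)"
  and level_sets: "F n \<subseteq> sets M"
  and level_mono: "m \<le> n \<Longrightarrow> F m \<subseteq> F n"
  using filtration by (auto simp: nary_filtration_def mono_def)

lemma level_Int: "A \<in> F n \<Longrightarrow> B \<in> F n \<Longrightarrow> A \<inter> B \<in> F n"
  using sigma_algebra_level[of n]
  by (simp add: sigma_algebra_def algebra_def ring_of_sets_def semiring_of_sets_def semiring_of_sets_axioms_def)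

lemma atom_mem_level: "A \<in> atoms_of (F n) \<Longrightarrow> A \<in> F n"
  and atom_nonempty: "A \<in> atoms_of (F n) \<Longrightarrow> A \<noteq> {}"
  by (simp_all add: atoms_of_def)

lemma atoms_sets: "atoms F \<subseteq> sets M"
proof
  fix A assume "A \<in> atoms F"
  then obtain n where "A \<in> atoms_of (F n)"
    by (auto simp: atoms_def)
  then show "A \<in> sets M"
    using level_sets[of n] atom_mem_level[of A n] by blast
qed

lemma rings_sets: "rings F \<subseteq> sets M"
  using atoms_sets by (auto simp: rings_def)

lemma atoms_nonempty: "{} \<notin> atoms F"
  using atom_nonempty by (auto simp: atoms_def)

lemma atom_level_dichotomy:
  assumes "m \<le> n" "A \<in> atoms_of (F m)" "B \<in> atoms_of (F n)" shows "B \<subseteq> A \<or> A \<inter> B = {}"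
  using atoms_of_eq_or_disjoint[of "F n" B A] level_Int assms level_mono[OF assms(1)] atom_mem_level[OF assms(2)]
  by blast

lemma atoms_nested_or_disjoint:
  assumes "A \<in> atoms F" "B \<in> atoms F" shows "A \<subseteq> B \<or> B \<subseteq> A \<or> A \<inter> B = {}"
proof -
  obtain m n where "A \<in> atoms_of (F m)" "B \<in> atoms_of (F n)"
    using assms by (auto simp: atoms_def)
  then show ?thesis
    using atom_level_dichotomy[of m n A B] atom_level_dichotomy[of n m B A] by (cases "m \<le> n") auto
qed

lemma disjoint_atoms_of: "disjoint (atoms_of (F n))"
proof (rule disjointI)
  fix A B assume "A \<in> atoms_of (F n)" "B \<in> atoms_of (F n)" "A \<noteq> B"
  then show "A \<inter> B = {}"
    using atom_level_dichotomy[of n n A B] atom_level_dichotomy[of n n B A] by blast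
qed

lemma space_atom: "space M \<in> atoms_of (F 0)"
  using filtration not_empty by (auto simp: nary_filtration_def atoms_of_def)

lemma children:
  assumes "A \<in> atoms_of (F n)"
  obtains \<B> where "\<B> \<subseteq> atoms_of (F (Suc n))" "finite \<B>" "card \<B> \<le> \<nu>" "A = \<Union>\<B>"
proof -
  have "\<forall>A\<in>atoms_of (F (Suc n - 1)). \<exists>\<B>\<subseteq>atoms_of (F (Suc n)). card \<B> \<le> \<nu> \<and> A = \<Union>\<B>"
    using filtration unfolding nary_filtration_def by fastforce
  then obtain \<B> where \<B>: "\<B> \<subseteq> atoms_of (F (Suc n))" "card \<B> \<le> \<nu>" "A = \<Union>\<B>"
    using assms by auto
  have "finite (atoms_of (F (Suc n)))"
    using finite_level[of "Suc n"] by (rule finite_subset[rotated]) (auto simp: atoms_of_def)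
  then show thesis
    using \<B> finite_subset that by blast
qed

text \<open>If the pieces were disjoint, then \<open>A - B\<close> would lie in the hole \<open>B'\<close> of the larger piece. As
  \<open>C\<close> meets \<open>A - B\<close> and is not contained in \<open>B'\<close>, the hole \<open>B'\<close> lies in \<open>C\<close>, and so does \<open>A - B\<close>; then \<open>C\<close>,
  being nested with \<open>B\<close> or disjoint from it, cannot split \<open>A - B\<close>.\<close>

lemma split_pieces_meet:
  assumes atoms: "C \<in> atoms F" "A \<in> atoms F" "A' \<in> atoms F"
    and B: "B \<in> insert {} (atoms F)" "B' \<in> insert {} (atoms F)"
    and split: "splits C A B" "splits C A' B'" and sub: "A \<subseteq> A'"
  shows "(A - B) \<inter> (A' - B') \<noteq> {}"
proof
  assume "(A - B) \<inter> (A' - B') = {}"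
  then have AB: "A - B \<subseteq> B'"
    using sub by blast
  have "C \<inter> B' \<noteq> {}" "\<not> C \<subseteq> B'"
    using AB split by (auto simp: splits_def)
  then have "B' \<subseteq> C"
    using B(2) atoms_nested_or_disjoint[OF atoms(1), of B'] by auto
  then have "A - B \<subseteq> C"
    using AB by simp
  moreover have "C \<subseteq> B \<or> B \<subseteq> C \<or> C \<inter> B = {}"
    using B(1) atoms_nested_or_disjoint[OF atoms(1), of B] by auto
  ultimately show False
    using split AB by (auto simp: splits_def)
qed

text \<open>This is the combinatorial core of the Bernstein inequality: among pairwise disjoint atoms and rings, an
  atom \<open>C\<close> splits at most one.\<close>

lemma splits_at_most_one:
  assumes "C \<in> atoms F" "A \<in> atoms F" "A' \<in> atoms F"
    and "B \<in> insert {} (atoms F)" "B' \<in> insert {} (atoms F)" "splits C A B" "splits C A' B'"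
  shows "(A - B) \<inter> (A' - B') \<noteq> {}"
proof -
  have "C \<subseteq> A \<inter> A'" "C \<noteq> {}"
    using assms atoms_nonempty by (auto simp: splits_def)
  then have "A \<subseteq> A' \<or> A' \<subseteq> A"
    using atoms_nested_or_disjoint[OF assms(2,3)] by auto
  then show ?thesis
    using split_pieces_meet[of C A A' B B'] split_pieces_meet[of C A' A B' B] assms by blast
qed

lemma unsplit_cut:
  assumes "scalar_fun.subspace S" "f \<in> S" "C \<in> atoms F" "A \<in> atoms F" "\<not> splits C A B"
  shows "\<exists>h\<in>S. \<forall>\<omega>\<in>A - B. cut f C \<omega> = h \<omega>"
proof (cases "A \<subseteq> C")
  case True
  then show ?thesis
    using assms(2) by (intro bexI[of _ f]) (auto simp: cut_def)
next
  case False
  then have "C \<inter> (A - B) = {}"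
    using atoms_nested_or_disjoint[OF assms(3,4)] assms(5) by (auto simp: splits_def)
  then show ?thesis
    using scalar_fun.subspace_0[OF assms(1)] by (intro bexI[of _ 0]) (auto simp: cut_def indicator_def)
qed

end

section \<open>The Bernstein inequality\<close>

lemma sum_function_apply: "(\<Sum>i\<in>I. f i) x = (\<Sum>i\<in>I. f i x)"
  by (induction I rule: infinite_finite_induct) auto

text \<open>A substitute for the tangent inequality of the concave function \<open>x \<mapsto> x\<^sup>s\<close> at \<open>t\<close>; in the power mean
  inequality it costs a factor \<open>2\<close>.\<close>

lemma powr_le_two_term_bound:
  fixes x t s :: real
  assumes "0 \<le> x" "0 < t" "0 < s" "s < 1"
  shows "x powr s \<le> t powr s + x * t powr (s - 1)"
proof (cases "x \<le> t")
  case True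
  then have "x powr s \<le> t powr s"
    using assms by (intro powr_mono2) auto
  also have "\<dots> \<le> t powr s + x * t powr (s - 1)"
    using assms by simp
  finally show ?thesis .
next
  case False
  then have "x powr s = x * x powr (s - 1)"
    using assms by (simp add: powr_diff)
  also have "\<dots> \<le> x * t powr (s - 1)"
    using False assms by (intro mult_left_mono powr_mono2') auto
  also have "\<dots> \<le> t powr s + x * t powr (s - 1)"
    by simp
  finally show ?thesis .
qed

lemma sum_ennpowr_le:
  fixes x :: "'i \<Rightarrow> ennreal"
  assumes "finite I" "card I \<le> n" "0 < n" "0 < s" "s < 1"
  shows "(\<Sum>i\<in>I. ennpowr (x i) s) \<le> ennreal (2 * real n powr (1 - s)) * ennpowr (\<Sum>i\<in>I. x i) s"
proof (cases "\<Sum>i\<in>I. x i")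
  case (real T)
  show ?thesis
  proof (cases "T = 0")
    case True
    then have "\<forall>i\<in>I. x i = 0"
      using real assms(1) by (simp add: sum_eq_0_iff)
    then show ?thesis by simp
  next
    case False
    \<comment> \<open>With this \<open>t\<close> both terms of the bound for \<open>x powr s\<close> have the same sum.\<close>
    define t where "t = T / real n"
    have T: "T > 0" and t: "t > 0"
      using False real assms by (auto simp: t_def)
    have "ennpowr (x i) s \<le> ennreal (t powr s) + x i * ennreal (t powr (s - 1))" if "i \<in> I" for i
    proof (cases "x i")
      case (real y)
      then show ?thesis
        using powr_le_two_term_bound[of y t s] t assms
        by (simp add: ennpowr_ennreal flip: ennreal_mult ennreal_plus)
    next
      case top
      then show ?thesis using t by (simp add: ennreal_top_mult)
    qed
    then have "(\<Sum>i\<in>I. ennpowr (x i) s) \<le> (\<Sum>i\<in>I. ennreal (t powr s) + x i * ennreal (t powr (s - 1)))"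
      by (rule sum_mono)
    also have "\<dots> = of_nat (card I) * ennreal (t powr s) + ennreal T * ennreal (t powr (s - 1))"
      by (simp add: sum.distrib sum_distrib_right[symmetric] real)
    also have "\<dots> \<le> of_nat n * ennreal (t powr s) + ennreal T * ennreal (t powr (s - 1))"
      using assms by (intro add_right_mono mult_right_mono) auto
    also have "\<dots> = ennreal (real n * t powr s + T * t powr (s - 1))"
      using T by (simp add: ennreal_mult ennreal_of_nat_eq_real_of_nat)
    also have "real n * t powr s + T * t powr (s - 1) = 2 * real n powr (1 - s) * T powr s"
      using T assms by (simp add: t_def powr_divide powr_diff)
    also have "ennreal \<dots> = ennreal (2 * real n powr (1 - s)) * ennpowr (\<Sum>i\<in>I. x i) s"
      using T by (simp add: real ennpowr_ennreal ennreal_mult)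
    finally show ?thesis .
  qed
next
  case top
  then show ?thesis
    unfolding top using assms by (simp add: ennreal_mult_top)
qed

context atomic_filtration
begin

text \<open>The function \<open>g\<close> coincides with an element of \<open>S\<close> on every atom or ring that is split by none of the \<open>n\<close>
  supports, and its local error vanishes there. In a disjoint collection at most \<open>n\<close> sets
  remain; on these the local error is at most the local \<open>L\<^sup>p\<close> norm, and the power mean inequality
  converts the \<open>\<sigma>\<close>-sum of \<open>n\<close> norms to a \<open>p\<close>-sum.\<close>

lemma bernstein_variation:
  fixes S :: "('a \<Rightarrow> 'k::{real_normed_field,euclidean_space}) set"
  assumes S: "scalar_fun.subspace S" and exponents: "0 < \<sigma>" "\<sigma> < p"
    and n: "0 < n" and g: "g \<in> n_term n (dict F S)" and [measurable]: "g \<in> borel_measurable M"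
  shows "variation M F S \<sigma> p g
    \<le> ennreal (2 powr (1 / \<sigma>) * real n powr (1 / \<sigma> - 1 / p)) * Lp_norm M p g"
proof (rule variation_leI[OF exponents(1)])
  fix \<R> assume \<R>: "finite \<R>" "\<R> \<subseteq> atoms F \<union> rings F" "disjoint \<R>"
  obtain c d where g_eq: "g = (\<Sum>i<n. fscale (c i) (d i))" "\<forall>i<n. d i \<in> dict F S"
    using g by (auto simp: n_term_def)
  then have "\<forall>i<n. \<exists>f C. d i = cut f C \<and> f \<in> S \<and> C \<in> atoms F"
    by (fastforce simp: dict_def)
  then obtain f C where fC: "\<And>i. i < n \<Longrightarrow> d i = cut (f i) (C i)" "\<And>i. i < n \<Longrightarrow> f i \<in> S"
    "\<And>i. i < n \<Longrightarrow> C i \<in> atoms F"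
    by metis
  have "\<forall>R\<in>\<R>. \<exists>A B. R = A - B \<and> A \<in> atoms F \<and> B \<in> insert {} (atoms F)"
  proof
    fix R assume "R \<in> \<R>"
    then have "R \<in> atoms F \<union> rings F"
      using \<R>(2) by blast
    then show "\<exists>A B. R = A - B \<and> A \<in> atoms F \<and> B \<in> insert {} (atoms F)"
      by (rule atom_or_ring_cases) blast
  qed
  then obtain A B where AB: "\<And>R. R \<in> \<R> \<Longrightarrow> R = A R - B R" "\<And>R. R \<in> \<R> \<Longrightarrow> A R \<in> atoms F"
    "\<And>R. R \<in> \<R> \<Longrightarrow> B R \<in> insert {} (atoms F)"
    by metis
  let ?E = "local_error M S p g"
  define \<R>' where "\<R>' = {R \<in> \<R>. ?E R \<noteq> 0}"
  have "\<exists>i<n. splits (C i) (A R) (B R)" if R: "R \<in> \<R>'" for R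
  proof (rule ccontr)
    assume not: "\<not> (\<exists>i<n. splits (C i) (A R) (B R))"
    have mem: "R \<in> \<R>"
      using R by (simp add: \<R>'_def)
    have "\<exists>h\<in>S. \<forall>\<omega>\<in>R. d i \<omega> = h \<omega>" if "i < n" for i
    proof -
      have "\<not> splits (C i) (A R) (B R)"
        using not that by blast
      from unsplit_cut[OF S fC(2)[OF that] fC(3)[OF that] AB(2)[OF mem] this]
      show ?thesis
        unfolding fC(1)[OF that] AB(1)[OF mem, symmetric] .
    qed
    then obtain h where h: "\<And>i. i < n \<Longrightarrow> h i \<in> S" "\<And>i \<omega>. i < n \<Longrightarrow> \<omega> \<in> R \<Longrightarrow> d i \<omega> = h i \<omega>"
      by metis
    define H where "H = (\<Sum>i<n. fscale (c i) (h i))"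
    have "H \<in> S"
      unfolding H_def using h by (intro scalar_fun.subspace_sum scalar_fun.subspace_scale S) auto
    have "g \<omega> = H \<omega>" if "\<omega> \<in> R" for \<omega>
      using h(2)[OF _ that] by (simp add: g_eq H_def sum_function_apply fscale_def)
    then have "Lp_norm_on M p R (g - H) = Lp_norm_on M p R (0 :: 'a \<Rightarrow> 'k)"
      by (intro Lp_norm_on_cong) simp
    then have "?E R = 0"
      using local_error_le[OF \<open>H \<in> S\<close>, of M p g R] by simp
    then show False
      using R by (simp add: \<R>'_def)
  qed
  then obtain \<phi> where \<phi>: "\<And>R. R \<in> \<R>' \<Longrightarrow> \<phi> R < n" "\<And>R. R \<in> \<R>' \<Longrightarrow> splits (C (\<phi> R)) (A R) (B R)"
    by metis
  have "inj_on \<phi> \<R>'"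
  proof (rule inj_onI)
    fix R R' assume R: "R \<in> \<R>'" "R' \<in> \<R>'" "\<phi> R = \<phi> R'"
    have "(A R - B R) \<inter> (A R' - B R') \<noteq> {}"
      using splits_at_most_one[of "C (\<phi> R)" "A R" "A R'" "B R" "B R'"] \<phi>[OF R(1)] \<phi>[OF R(2)] R fC(3) AB
      by (simp add: \<R>'_def)
    then have "R \<inter> R' \<noteq> {}"
      using AB(1) R by (simp add: \<R>'_def)
    then show "R = R'"
      using R \<R>(3) by (auto simp: \<R>'_def disjoint_def)
  qed
  then have card: "card \<R>' \<le> n" and fin: "finite \<R>'"
    using \<phi>(1) card_inj_on_le[of \<phi> \<R>' "{..<n}"] \<R>(1) by (auto simp: \<R>'_def)
  have "(\<Sum>R\<in>\<R>. ennpowr (?E R) \<sigma>) = (\<Sum>R\<in>\<R>'. ennpowr (?E R) \<sigma>)"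
    using \<R>(1) by (intro sum.mono_neutral_right) (auto simp: \<R>'_def)
  also have "\<dots> \<le> (\<Sum>R\<in>\<R>'. ennpowr (ennpowr (Lp_norm_on M p R g) p) (\<sigma> / p))"
  proof (rule sum_mono)
    fix R assume "R \<in> \<R>'"
    have "?E R \<le> Lp_norm_on M p R g"
      using local_error_le[OF scalar_fun.subspace_0[OF S], of M p g R] by simp
    then show "ennpowr (?E R) \<sigma> \<le> ennpowr (ennpowr (Lp_norm_on M p R g) p) (\<sigma> / p)"
      using exponents by (simp add: ennpowr_ennpowr ennpowr_mono)
  qed
  also have "\<dots> \<le> ennreal (2 * real n powr (1 - \<sigma> / p)) *
      ennpowr (\<Sum>R\<in>\<R>'. ennpowr (Lp_norm_on M p R g) p) (\<sigma> / p)"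
    using exponents by (intro sum_ennpowr_le fin card n) auto
  also have "\<dots> \<le> ennreal (2 * real n powr (1 - \<sigma> / p)) * ennpowr (ennpowr (Lp_norm M p g) p) (\<sigma> / p)"
    using exponents \<R> fin rings_sets atoms_sets
    by (intro mult_left_mono ennpowr_mono sum_Lp_norm_on_powr_le) (auto simp: \<R>'_def disjoint_def)
  also have "\<dots> = ennpowr (ennreal (2 powr (1 / \<sigma>) * real n powr (1 / \<sigma> - 1 / p)) * Lp_norm M p g) \<sigma>"
  proof -
    have "(2 powr (1 / \<sigma>) * real n powr (1 / \<sigma> - 1 / p)) powr \<sigma> = 2 * real n powr (1 - \<sigma> / p)"
      using exponents by (simp add: powr_mult powr_powr left_diff_distrib)
    then show ?thesis
      using exponents by (simp add: ennpowr_mult ennpowr_ennreal ennpowr_ennpowr)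
  qed
  finally show "(\<Sum>R\<in>\<R>. ennpowr (?E R) \<sigma>)
      \<le> ennpowr (ennreal (2 powr (1 / \<sigma>) * real n powr (1 / \<sigma> - 1 / p)) * Lp_norm M p g) \<sigma>" .
qed

end

section \<open>The Jackson inequality\<close>

lemma cut_diff:
  "B \<subseteq> A \<Longrightarrow> cut h A - cut h B = cut h (A - B)"
  by (auto simp: cut_def fun_eq_iff indicator_def)

lemma dict_subset_n_term: "d \<in> D \<Longrightarrow> d \<in> n_term (Suc 0) D"
  unfolding n_term_def
  by (intro CollectI exI[of _ "\<lambda>_. 1"] exI[of _ "\<lambda>_. d"]) (simp add: fscale_def)

lemma zero_in_dict:
  assumes "scalar_fun.subspace S" "A \<in> atoms F" shows "0 \<in> dict F S"
  unfolding dict_def using assms scalar_fun.subspace_0[OF assms(1)]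
  by (intro CollectI exI[of _ 0] exI[of _ A]) (auto simp: cut_def fun_eq_iff)

text \<open>For the Jackson inequality fix a function \<open>f\<close> and a threshold \<open>\<epsilon>\<close>. A set is good if \<open>S\<close> approximates \<open>f\<close> on
  it up to \<open>\<epsilon>\<close>. The aim is to partition \<open>\<Omega>\<close> into good atoms and rings, the number of which is controlled by
  the size of a disjoint family of bad ones. The partition is not recorded as a family of sets: what is
  needed of a partition of \<open>R\<close> into \<open>m\<close> good pieces is that \<open>f\<close> can be approximated on \<open>R\<close> with
  \<open>2 m\<close> dictionary elements, two per ring, and with error \<open>m \<epsilon>\<^sup>p\<close> in the \<open>p\<close>-th power.\<close>

locale threshold_approximation = atomic_filtration M \<nu> F
  for M :: "'a measure" and \<nu> F +
  fixes S :: "('a \<Rightarrow> 'k::{real_normed_field,euclidean_space}) set" and p \<epsilon> :: real and f :: "'a \<Rightarrow> 'k"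
  assumes subspace: "scalar_fun.subspace S" and S_measurable: "S \<subseteq> borel_measurable M"
    and f_measurable [measurable]: "f \<in> borel_measurable M" and p_pos: "0 < p" and \<epsilon>_nonneg: "0 \<le> \<epsilon>"
begin

definition good :: "'a set \<Rightarrow> bool" where
  "good R \<longleftrightarrow> (\<exists>h\<in>S. Lp_norm_on M p R (f - h) \<le> ennreal \<epsilon>)"

definition approximable :: "'a set \<Rightarrow> nat \<Rightarrow> bool" where
  "approximable R m \<longleftrightarrow> (\<exists>y\<in>n_term (2 * m) (dict F S). (\<forall>\<omega>. \<omega> \<notin> R \<longrightarrow> y \<omega> = 0) \<and>
    (\<integral>\<^sup>+\<omega>\<in>R. ennreal (norm ((f - y) \<omega>) powr p) \<partial>M) \<le> of_nat m * ennreal (\<epsilon> powr p))"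

definition packing :: "'a set \<Rightarrow> nat \<Rightarrow> bool" where
  "packing R k \<longleftrightarrow> (\<exists>\<R>. finite \<R> \<and> \<R> \<subseteq> atoms F \<union> rings F \<and> disjoint \<R> \<and> \<Union>\<R> \<subseteq> R \<and> card \<R> = k \<and>
    (\<forall>P\<in>\<R>. ennreal \<epsilon> \<le> local_error M S p f P))"

lemma space_mem_atoms: "space M \<in> atoms F"
  using space_atom by (auto simp: atoms_def)

lemma zero_dict: "0 \<in> dict F S"
  using zero_in_dict[OF subspace space_mem_atoms] .

lemma dict_measurable: "dict F S \<subseteq> borel_measurable M"
proof
  fix d assume "d \<in> dict F S"
  then obtain h A where "d = cut h A" "h \<in> S" "A \<in> atoms F"
    by (auto simp: dict_def)
  moreover from this have [measurable]: "A \<in> sets M" "h \<in> borel_measurable M"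
    using atoms_sets S_measurable by auto
  ultimately show "d \<in> borel_measurable M"
    by (simp add: cut_def)
qed

lemma n_term_measurable: "y \<in> n_term n (dict F S) \<Longrightarrow> y \<in> borel_measurable M"
proof -
  assume "y \<in> n_term n (dict F S)"
  then obtain c d where "y = (\<Sum>i<n. fscale (c i) (d i))" and d: "\<forall>i<n. d i \<in> dict F S"
    by (auto simp: n_term_def)
  then have "y = (\<lambda>\<omega>. \<Sum>i<n. c i * d i \<omega>)"
    by (simp add: fun_eq_iff sum_function_apply fscale_def)
  moreover have "d i \<in> borel_measurable M" if "i < n" for i
    using d that dict_measurable by auto
  ultimately show ?thesis
    by (auto intro!: borel_measurable_sum borel_measurable_times)
qed

lemma good_empty: "good {}"
  unfolding good_def using scalar_fun.subspace_0[OF subspace]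
  by (intro bexI[of _ 0]) (simp_all add: Lp_norm_on_def)

lemma approximable_empty: "approximable {} 0"
  unfolding approximable_def by (intro bexI[of _ 0]) (auto simp: zero_in_n_term[OF zero_dict])

lemma approximable_mono:
  assumes "approximable R m" "m \<le> n" shows "approximable R n"
proof -
  have "n_term (2 * m) (dict F S) \<subseteq> n_term (2 * n) (dict F S)"
    using assms(2) by (intro n_term_mono zero_dict) simp
  moreover have "of_nat m * ennreal (\<epsilon> powr p) \<le> of_nat n * ennreal (\<epsilon> powr p)"
    using assms(2) by (intro mult_right_mono) auto
  ultimately show ?thesis
    using assms(1) unfolding approximable_def by (meson order_trans subsetD)
qed

lemma approximable_good:
  assumes "good (A - B)" "A \<in> atoms F" "B \<in> insert {} (atoms F)" "B \<subseteq> A"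
  shows "approximable (A - B) 1"
proof -
  obtain h where h: "h \<in> S" "Lp_norm_on M p (A - B) (f - h) \<le> ennreal \<epsilon>"
    using assms(1) by (auto simp: good_def)
  have "cut h A \<in> dict F S"
    using h assms by (auto simp: dict_def)
  moreover have "cut h B \<in> dict F S"
  proof (cases "B = {}")
    case True
    then have "cut h B = 0"
      by (simp add: cut_def fun_eq_iff)
    then show ?thesis
      using zero_dict by simp
  next
    case False
    then show ?thesis
      using h assms by (auto simp: dict_def)
  qed
  ultimately have "cut h A - cut h B \<in> n_term (Suc 0 + Suc 0) (dict F S)"
    by (intro n_term_diff dict_subset_n_term)
  then have mem: "cut h (A - B) \<in> n_term (2 * 1) (dict F S)"
    using assms(4) by (simp add: cut_diff numeral_2_eq_2)
  have "Lp_norm_on M p (A - B) (f - cut h (A - B)) = Lp_norm_on M p (A - B) (f - h)"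
    by (intro Lp_norm_on_cong) (simp add: cut_def)
  then have "Lp_norm_on M p (A - B) (f - cut h (A - B)) \<le> ennreal \<epsilon>"
    using h by simp
  then have "(\<integral>\<^sup>+\<omega>\<in>A - B. ennreal (norm ((f - cut h (A - B)) \<omega>) powr p) \<partial>M) \<le> of_nat 1 * ennreal (\<epsilon> powr p)"
    unfolding Lp_norm_on_le_iff[OF p_pos] using \<epsilon>_nonneg by (simp add: ennpowr_ennreal)
  with mem show ?thesis
    unfolding approximable_def by (intro bexI[of _ "cut h (A - B)"]) (auto simp: cut_def)
qed

lemma approximable_Un:
  assumes "approximable R m" "approximable R' m'" "R \<inter> R' = {}"
    and [measurable]: "R \<in> sets M" "R' \<in> sets M"
  shows "approximable (R \<union> R') (m + m')"
proof -
  obtain y where y: "y \<in> n_term (2 * m) (dict F S)" "\<forall>\<omega>. \<omega> \<notin> R \<longrightarrow> y \<omega> = 0"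
    "(\<integral>\<^sup>+\<omega>\<in>R. ennreal (norm ((f - y) \<omega>) powr p) \<partial>M) \<le> of_nat m * ennreal (\<epsilon> powr p)"
    using assms(1) by (auto simp: approximable_def)
  obtain y' where y': "y' \<in> n_term (2 * m') (dict F S)" "\<forall>\<omega>. \<omega> \<notin> R' \<longrightarrow> y' \<omega> = 0"
    "(\<integral>\<^sup>+\<omega>\<in>R'. ennreal (norm ((f - y') \<omega>) powr p) \<partial>M) \<le> of_nat m' * ennreal (\<epsilon> powr p)"
    using assms(2) by (auto simp: approximable_def)
  have [measurable]: "y \<in> borel_measurable M" "y' \<in> borel_measurable M"
    using y y' n_term_measurable by auto
  have "(\<integral>\<^sup>+\<omega>\<in>R \<union> R'. ennreal (norm ((f - (y + y')) \<omega>) powr p) \<partial>M)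
      = (\<integral>\<^sup>+\<omega>. ennreal (norm ((f - y) \<omega>) powr p) * indicator R \<omega>
          + ennreal (norm ((f - y') \<omega>) powr p) * indicator R' \<omega> \<partial>M)"
    using y(2) y'(2) assms(3) by (intro nn_integral_cong) (auto simp: indicator_def)
  also have "\<dots> = (\<integral>\<^sup>+\<omega>\<in>R. ennreal (norm ((f - y) \<omega>) powr p) \<partial>M)
      + (\<integral>\<^sup>+\<omega>\<in>R'. ennreal (norm ((f - y') \<omega>) powr p) \<partial>M)"
    by (rule nn_integral_add) (simp_all add: fun_diff_def)
  also have "\<dots> \<le> of_nat (m + m') * ennreal (\<epsilon> powr p)"
    using add_mono[OF y(3) y'(3)] by (simp add: distrib_right)
  finally show ?thesis
    using n_term_add[OF y(1) y'(1)] y(2) y'(2) unfolding approximable_def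
    by (intro bexI[of _ "y + y'"]) (auto simp: distrib_left)
qed

lemma approximable_Union:
  assumes "finite \<R>" "disjoint \<R>" "\<R> \<subseteq> sets M" "\<And>R. R \<in> \<R> \<Longrightarrow> approximable R (m R)"
  shows "approximable (\<Union>\<R>) (\<Sum>R\<in>\<R>. m R)"
  using assms
proof (induction \<R> rule: finite_induct)
  case empty
  then show ?case by (simp add: approximable_empty)
next
  case (insert R \<R>)
  have "approximable (R \<union> \<Union>\<R>) (m R + (\<Sum>R\<in>\<R>. m R))"
  proof (rule approximable_Un)
    show "approximable (\<Union>\<R>) (\<Sum>R\<in>\<R>. m R)"
      using insert.prems by (intro insert.IH) (auto simp: disjoint_def)
    show "R \<inter> \<Union>\<R> = {}"
      using insert.prems(1) insert.hyps(2) by (auto simp: disjoint_def)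
    show "\<Union>\<R> \<in> sets M"
      using insert by (intro sets.finite_Union) auto
  qed (use insert.prems in auto)
  then show ?case
    using insert.hyps by simp
qed

lemma packing_empty: "packing R 0"
  unfolding packing_def by (intro exI[of _ "{}"]) auto

lemma packing_mono:
  assumes "packing R k" "R \<subseteq> R'" shows "packing R' k"
proof -
  obtain \<R> where "finite \<R>" "\<R> \<subseteq> atoms F \<union> rings F" "disjoint \<R>" "\<Union>\<R> \<subseteq> R" "card \<R> = k"
    "\<forall>P\<in>\<R>. ennreal \<epsilon> \<le> local_error M S p f P"
    using assms(1) by (auto simp: packing_def)
  moreover from this have "\<Union>\<R> \<subseteq> R'"
    using assms(2) by blast
  ultimately show ?thesis
    unfolding packing_def by (intro exI[of _ \<R>]) auto
qed

lemma packing_not_good: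
  assumes "R \<in> atoms F \<union> rings F" "\<not> good R" shows "packing R 1"
proof -
  have "ennreal \<epsilon> \<le> local_error M S p f R"
    using assms(2) unfolding good_def local_error_eq by (intro INF_greatest) auto
  then show ?thesis
    using assms(1) unfolding packing_def by (intro exI[of _ "{R}"]) auto
qed

lemma packing_Un:
  assumes "packing R k" "packing R' k'" "R \<inter> R' = {}" shows "packing (R \<union> R') (k + k')"
proof -
  obtain \<R> where R: "finite \<R>" "\<R> \<subseteq> atoms F \<union> rings F" "disjoint \<R>" "\<Union>\<R> \<subseteq> R" "card \<R> = k"
    "\<forall>P\<in>\<R>. ennreal \<epsilon> \<le> local_error M S p f P"
    using assms(1) by (auto simp: packing_def)
  obtain \<R>' where R': "finite \<R>'" "\<R>' \<subseteq> atoms F \<union> rings F" "disjoint \<R>'" "\<Union>\<R>' \<subseteq> R'" "card \<R>' = k'"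
    "\<forall>P\<in>\<R>'. ennreal \<epsilon> \<le> local_error M S p f P"
    using assms(2) by (auto simp: packing_def)
  have "{} \<notin> atoms F \<union> rings F"
    using atoms_nonempty by (auto simp: rings_def)
  moreover have "P = {}" if "P \<in> \<R>" "P \<in> \<R>'" for P
    using R(4) R'(4) assms(3) that by blast
  ultimately have "\<R> \<inter> \<R>' = {}"
    using R(2) by blast
  then have "card (\<R> \<union> \<R>') = k + k'"
    using R R' by (simp add: card_Un_disjoint)
  moreover have "disjoint (\<R> \<union> \<R>')"
  proof (rule disjoint_union)
    show "\<Union>\<R> \<inter> \<Union>\<R>' = {}"
      using R(4) R'(4) assms(3) by blast
  qed (use R R' in auto)
  ultimately show ?thesis
    unfolding packing_def using R R' by (intro exI[of _ "\<R> \<union> \<R>'"]) auto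
qed

lemma packing_Union:
  assumes "finite \<R>" "disjoint \<R>" "\<And>R. R \<in> \<R> \<Longrightarrow> packing R (k R)"
  shows "packing (\<Union>\<R>) (\<Sum>R\<in>\<R>. k R)"
  using assms
proof (induction \<R> rule: finite_induct)
  case empty
  then show ?case by (simp add: packing_empty)
next
  case (insert R \<R>)
  have "packing (R \<union> \<Union>\<R>) (k R + (\<Sum>R\<in>\<R>. k R))"
  proof (rule packing_Un)
    show "packing (\<Union>\<R>) (\<Sum>R\<in>\<R>. k R)"
      using insert.prems by (intro insert.IH) (auto simp: disjoint_def)
    show "R \<inter> \<Union>\<R> = {}"
      using insert.prems(1) insert.hyps(2) by (auto simp: disjoint_def)
  qed (use insert.prems in auto)
  then show ?case
    using insert.hyps by simp
qed

text \<open>The invariant of a recursion that runs through the tree from the leaves to the root. In a bad atom \<open>A\<close> one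
  keeps an atom \<open>B \<subseteq> A\<close>, the lower end of a chain of atoms which starts at \<open>A\<close>: the
  ring \<open>A - B\<close> is still good, and \<open>B\<close> is already dealt with. The term \<open>- \<nu>\<close> in the count is
  the reserve that pays for the at most \<open>\<nu>\<close> additional pieces when two or more bad children meet.\<close>

definition resolved :: "'a set \<Rightarrow> bool" where
  "resolved A \<longleftrightarrow> good A \<or> (\<exists>B\<in>atoms F. \<exists>k\<ge>1. B \<subseteq> A \<and> good (A - B) \<and>
    approximable B (2 * \<nu> * k - \<nu>) \<and> packing B k)"

text \<open>There are three cases, according to the number of bad children. If there is none, then
  \<open>A\<close> is a bad set by itself and its children are good pieces. If there is exactly one, then the chain
  is continued upwards to \<open>A\<close> as long as the ring above its lower end is good; once this ring is bad, it joins
  the packing, which pays for ending the chain. If there are two or more, all their chains end, and the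
  reserves of two children cover both the reserve to be kept and the at most \<open>\<nu>\<close> pieces that are added.\<close>

lemma resolved_step:
  assumes A: "A \<in> atoms_of (F n)"
    and IH: "\<And>C. C \<in> atoms_of (F (Suc n)) \<Longrightarrow> resolved C"
  shows "resolved A"
proof (cases "good A")
  case True
  then show ?thesis by (simp add: resolved_def)
next
  case False
  have A_atom: "A \<in> atoms F"
    using A by (auto simp: atoms_def)
  obtain \<B> where \<B>: "\<B> \<subseteq> atoms_of (F (Suc n))" "finite \<B>" "card \<B> \<le> \<nu>" "A = \<Union>\<B>"
    using children[OF A] .
  have \<B>_atoms: "\<B> \<subseteq> atoms F"
    using \<B>(1) by (auto simp: atoms_def)
  then have \<B>_sets: "\<B> \<subseteq> sets M"
    using atoms_sets by auto
  have \<B>_disjoint: "disjoint \<B>"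
    using \<B>(1) disjoint_atoms_of[of "Suc n"] by (auto simp: disjoint_def)
  define \<H> where "\<H> = {C \<in> \<B>. \<not> good C}"
  have \<H>: "\<H> \<subseteq> \<B>" "finite \<H>"
    using \<B>(2) by (auto simp: \<H>_def)
  have "\<forall>C\<in>\<H>. \<exists>B k. B \<in> atoms F \<and> k \<ge> 1 \<and> B \<subseteq> C \<and> good (C - B) \<and>
      approximable B (2 * \<nu> * k - \<nu>) \<and> packing B k"
  proof
    fix C assume C: "C \<in> \<H>"
    then have "resolved C"
      using IH \<B>(1) \<H>(1) by blast
    then show "\<exists>B k. B \<in> atoms F \<and> k \<ge> 1 \<and> B \<subseteq> C \<and> good (C - B) \<and>
        approximable B (2 * \<nu> * k - \<nu>) \<and> packing B k"
      using C unfolding resolved_def \<H>_def by blast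
  qed
  then have "\<exists>b k. \<forall>C\<in>\<H>. b C \<in> atoms F \<and> k C \<ge> 1 \<and> b C \<subseteq> C \<and> good (C - b C) \<and>
      approximable (b C) (2 * \<nu> * k C - \<nu>) \<and> packing (b C) (k C)"
    unfolding bchoice_iff .
  then obtain b k where "\<forall>C\<in>\<H>. b C \<in> atoms F \<and> k C \<ge> 1 \<and> b C \<subseteq> C \<and> good (C - b C) \<and>
      approximable (b C) (2 * \<nu> * k C - \<nu>) \<and> packing (b C) (k C)"
    by blast
  then have bk: "\<And>C. C \<in> \<H> \<Longrightarrow> b C \<in> atoms F" "\<And>C. C \<in> \<H> \<Longrightarrow> k C \<ge> (1::nat)"
    "\<And>C. C \<in> \<H> \<Longrightarrow> b C \<subseteq> C" "\<And>C. C \<in> \<H> \<Longrightarrow> good (C - b C)"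
    "\<And>C. C \<in> \<H> \<Longrightarrow> approximable (b C) (2 * \<nu> * k C - \<nu>)" "\<And>C. C \<in> \<H> \<Longrightarrow> packing (b C) (k C)"
    by auto
  \<comment> \<open>A good child is one piece; a bad child adds one ring to the pieces in the lower end of its chain.\<close>
  define m where "m C = (if C \<in> \<H> then 1 + (2 * \<nu> * k C - \<nu>) else 1)" for C
  have "approximable C (m C)" if C: "C \<in> \<B>" for C
  proof (cases "C \<in> \<H>")
    case True
    have "approximable (C - b C \<union> b C) (1 + (2 * \<nu> * k C - \<nu>))"
    proof (rule approximable_Un)
      show "approximable (C - b C) 1"
        using True bk C \<B>_atoms by (intro approximable_good) auto
      show "approximable (b C) (2 * \<nu> * k C - \<nu>)" "(C - b C) \<inter> b C = {}"
        using True bk by auto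
      have "C \<in> sets M" "b C \<in> sets M"
        using True bk C \<B>_atoms atoms_sets by auto
      then show "C - b C \<in> sets M" "b C \<in> sets M"
        by auto
    qed
    moreover have "C - b C \<union> b C = C"
      using bk(3)[OF True] by auto
    ultimately show ?thesis
      using True by (simp add: m_def)
  next
    case False
    then show ?thesis
      using approximable_good[of C "{}"] C \<B>_atoms by (auto simp: m_def \<H>_def)
  qed
  then have approx_A: "approximable A (\<Sum>C\<in>\<B>. m C)"
    unfolding \<B>(4) by (intro approximable_Union \<B>_disjoint \<B>_sets \<B>(2))
  have sum_m: "(\<Sum>C\<in>\<B>. m C) + \<nu> * card \<H> = card \<B> + 2 * \<nu> * (\<Sum>C\<in>\<H>. k C)"
  proof -
    have "(\<Sum>C\<in>\<B>. m C) = (\<Sum>C\<in>\<B>. 1 + (if C \<in> \<H> then 2 * \<nu> * k C - \<nu> else 0))"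
      by (intro sum.cong) (auto simp: m_def)
    also have "\<dots> = card \<B> + (\<Sum>C\<in>\<B>. if C \<in> \<H> then 2 * \<nu> * k C - \<nu> else 0)"
      by (subst sum.distrib) simp
    also have "(\<Sum>C\<in>\<B>. if C \<in> \<H> then 2 * \<nu> * k C - \<nu> else 0) = (\<Sum>C\<in>\<H>. 2 * \<nu> * k C - \<nu>)"
      using \<B>(2) \<H>(1) by (subst sum.inter_restrict[symmetric]) (auto simp: Int_absorb1)
    finally have "(\<Sum>C\<in>\<B>. m C) + \<nu> * card \<H> = card \<B> + ((\<Sum>C\<in>\<H>. 2 * \<nu> * k C - \<nu>) + (\<Sum>C\<in>\<H>. \<nu>))"
      by (simp add: mult.commute)
    also have "(\<Sum>C\<in>\<H>. 2 * \<nu> * k C - \<nu>) + (\<Sum>C\<in>\<H>. \<nu>) = (\<Sum>C\<in>\<H>. 2 * \<nu> * k C)"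
      unfolding sum.distrib[symmetric]
    proof (intro sum.cong refl)
      fix C assume "C \<in> \<H>"
      then have "\<nu> * 1 \<le> \<nu> * (2 * k C)"
        using bk(2)[of C] by (intro mult_left_mono) auto
      then show "2 * \<nu> * k C - \<nu> + \<nu> = 2 * \<nu> * k C"
        by (simp add: mult_ac)
    qed
    finally show ?thesis
      by (simp add: sum_distrib_left)
  qed
  \<comment> \<open>In all cases but one the chain ends at \<open>A\<close>, and only the number of pieces has to be checked.\<close>
  have resolved_A: "resolved A" if "k \<ge> 1" "(\<Sum>C\<in>\<B>. m C) + \<nu> \<le> 2 * \<nu> * k" "packing A k" for k
  proof -
    have "approximable A (2 * \<nu> * k - \<nu>)"
      using that(2) by (intro approximable_mono[OF approx_A]) simp
    then show ?thesis
      using that A_atom good_empty unfolding resolved_def by (intro disjI2 bexI[of _ A] exI[of _ k]) auto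
  qed
  consider "\<H> = {}" | C where "\<H> = {C}" | "card \<H> \<ge> 2"
    by (metis One_nat_def Suc_1 card_0_eq card_1_singletonE \<H>(2) le_less_linear less_2_cases)
  then show ?thesis
  proof cases
    case 1
    then show ?thesis
      using sum_m \<B>(3) packing_not_good[of A] A_atom False by (intro resolved_A[of 1]) auto
  next
    case (2 C)
    then have C: "C \<in> \<H>" "C \<subseteq> A"
      using \<H>(1) \<B>(4) by auto
    show ?thesis
    proof (cases "good (A - b C)")
      case True
      \<comment> \<open>Nothing is charged: the siblings of \<open>C\<close> are absorbed in the ring \<open>A - b C\<close>.\<close>
      then show ?thesis
        unfolding resolved_def using bk[OF C(1)] C(2) by (intro disjI2 bexI[of _ "b C"] exI[of _ "k C"]) auto
    next
      case False
      then have "A - b C \<noteq> {}"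
        using good_empty by metis
      then have "A - b C \<in> rings F"
        unfolding rings_def using A_atom bk[OF C(1)] C(2) by blast
      then have "packing (A - b C) 1"
        using False by (intro packing_not_good) auto
      then have "packing (A - b C \<union> b C) (1 + k C)"
        using bk(6)[OF C(1)] by (intro packing_Un) auto
      moreover have "A - b C \<union> b C = A"
        using bk(3)[OF C(1)] C(2) by auto
      ultimately have "packing A (1 + k C)"
        by simp
      moreover have "(\<Sum>C\<in>\<B>. m C) + \<nu> \<le> 2 * \<nu> * (1 + k C)"
        using sum_m \<B>(3) 2 by simp
      ultimately show ?thesis
        by (intro resolved_A[of "1 + k C"]) auto
    qed
  next
    case 3
    have "packing (\<Union>\<H>) (\<Sum>C\<in>\<H>. k C)"
    proof (rule packing_Union[OF \<H>(2)])
      show "disjoint \<H>"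
        using \<B>_disjoint \<H>(1) by (auto simp: disjoint_def)
      show "packing C (k C)" if "C \<in> \<H>" for C
        using bk(3,6)[OF that] by (rule packing_mono[rotated])
    qed
    then have pack: "packing A (\<Sum>C\<in>\<H>. k C)"
      using \<H>(1) \<B>(4) by (auto intro: packing_mono)
    have "card \<H> \<le> (\<Sum>C\<in>\<H>. k C)"
      using sum_mono[of \<H> "\<lambda>_. 1" k] bk(2) by simp
    then have "1 \<le> (\<Sum>C\<in>\<H>. k C)"
      using 3 by linarith
    moreover have "\<nu> * 2 \<le> \<nu> * card \<H>"
      using 3 by (rule mult_le_mono2)
    then have "(\<Sum>C\<in>\<B>. m C) + \<nu> \<le> 2 * \<nu> * (\<Sum>C\<in>\<H>. k C)"
      using sum_m \<B>(3) by linarith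
    ultimately show ?thesis
      using pack by (rule resolved_A)
  qed
qed

lemma resolved_atom:
  assumes "\<And>A. A \<in> atoms_of (F N) \<Longrightarrow> good A" "n \<le> N" "A \<in> atoms_of (F n)"
  shows "resolved A"
  using assms(2,3)
proof (induction arbitrary: A rule: inc_induct)
  case base
  then show ?case
    using assms(1) by (simp add: resolved_def)
next
  case (step n)
  then show ?case
    using resolved_step by blast
qed

lemma approximable_space:
  assumes "\<And>A. A \<in> atoms_of (F N) \<Longrightarrow> good A"
  obtains k where "packing (space M) k" "approximable (space M) (1 + 2 * \<nu> * k)"
proof -
  have "resolved (space M)"
    using resolved_atom[OF assms _ space_atom] by simp
  then consider "good (space M)" | B k where "B \<in> atoms F" "B \<subseteq> space M" "good (space M - B)"
      "approximable B (2 * \<nu> * k - \<nu>)" "packing B k"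
    unfolding resolved_def by blast
  then show thesis
  proof cases
    case 1
    then have "approximable (space M) 1"
      using approximable_good[of "space M" "{}"] space_mem_atoms by simp
    then show thesis
      using that[of 0] packing_empty by simp
  next
    case (2 B k)
    have "approximable (space M - B) 1"
      using 2 space_mem_atoms by (intro approximable_good) auto
    then have "approximable (space M - B \<union> B) (1 + (2 * \<nu> * k - \<nu>))"
      using 2 atoms_sets by (intro approximable_Un) auto
    then have "approximable (space M) (1 + (2 * \<nu> * k - \<nu>))"
      using 2(2) by (simp add: Un_absorb2)
    then have "approximable (space M) (1 + 2 * \<nu> * k)"
      by (rule approximable_mono) simp
    then show thesis
      using that packing_mono[OF 2(5,2)] by blast
  qed
qed

text \<open>Each set of the packing contributes at least \<open>\<epsilon>\<^sup>\<sigma>\<close> to the variation (Chebyshev).\<close>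

lemma packing_card_le:
  assumes "packing R k" "0 < \<sigma>" "variation M F S \<sigma> p f \<le> ennreal t" "0 \<le> t"
  shows "real k * \<epsilon> powr \<sigma> \<le> t powr \<sigma>"
proof -
  obtain \<R> where R: "finite \<R>" "\<R> \<subseteq> atoms F \<union> rings F" "disjoint \<R>" "card \<R> = k"
    "\<forall>P\<in>\<R>. ennreal \<epsilon> \<le> local_error M S p f P"
    using assms(1) by (auto simp: packing_def)
  have "ennreal (real k * \<epsilon> powr \<sigma>) = (\<Sum>P\<in>\<R>. ennpowr (ennreal \<epsilon>) \<sigma>)"
    using R(4) \<epsilon>_nonneg by (simp add: ennpowr_ennreal ennreal_mult ennreal_of_nat_eq_real_of_nat)
  also have "\<dots> \<le> (\<Sum>P\<in>\<R>. ennpowr (local_error M S p f P) \<sigma>)"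
    using R(5) assms(2) by (intro sum_mono ennpowr_mono) auto
  also have "\<dots> \<le> ennpowr (variation M F S \<sigma> p f) \<sigma>"
    using R assms(2) by (intro variation_ge)
  also have "\<dots> \<le> ennpowr (ennreal t) \<sigma>"
    using assms by (intro ennpowr_mono)
  finally show ?thesis
    using assms by (simp add: ennpowr_ennreal)
qed

end

context atomic_filtration
begin

text \<open>This makes the tree of bad atoms finite: an element of \<open>L\<^sup>p(S)\<close> is up to \<open>\<epsilon>\<close> a member of the
  span, so all atoms of a sufficiently fine level are good.\<close>

lemma span_dict_locally_in_S:
  fixes S :: "('a \<Rightarrow> 'k::{real_normed_field,euclidean_space}) set"
  assumes S: "scalar_fun.subspace S" and h: "h \<in> scalar_fun.span (dict F S)"
  shows "\<forall>\<^sub>F n in sequentially. \<forall>A\<in>atoms_of (F n). \<exists>s\<in>S. \<forall>\<omega>\<in>A. h \<omega> = s \<omega>"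
proof -
  define P where "P h n \<longleftrightarrow> (\<forall>A\<in>atoms_of (F n). \<exists>s\<in>S. \<forall>\<omega>\<in>A. h \<omega> = s \<omega>)" for h :: "'a \<Rightarrow> 'k" and n
  have P_zero: "P 0 n" for n
    using scalar_fun.subspace_0[OF S] unfolding P_def by (intro ballI bexI[of _ "0 :: 'a \<Rightarrow> 'k"]) auto
  have P_add: "P (h + h') n" if hyps: "P h n" "P h' n" for h h' n
    unfolding P_def
  proof
    fix A assume "A \<in> atoms_of (F n)"
    then obtain s s' where "s \<in> S" "\<forall>\<omega>\<in>A. h \<omega> = s \<omega>" "s' \<in> S" "\<forall>\<omega>\<in>A. h' \<omega> = s' \<omega>"
      using hyps unfolding P_def by metis
    then show "\<exists>s\<in>S. \<forall>\<omega>\<in>A. (h + h') \<omega> = s \<omega>"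
      using scalar_fun.subspace_add[OF S] by (intro bexI[of _ "s + s'"]) auto
  qed
  have P_scale: "P (fscale c h) n" if hyps: "P h n" for c h n
    unfolding P_def
  proof
    fix A assume "A \<in> atoms_of (F n)"
    then obtain s where "s \<in> S" "\<forall>\<omega>\<in>A. h \<omega> = s \<omega>"
      using hyps unfolding P_def by metis
    then show "\<exists>s\<in>S. \<forall>\<omega>\<in>A. fscale c h \<omega> = s \<omega>"
      using scalar_fun.subspace_scale[OF S] by (intro bexI[of _ "fscale c s"]) (auto simp: fscale_def)
  qed
  have P_dict: "\<forall>\<^sub>F n in sequentially. P d n" if dict: "d \<in> dict F S" for d
  proof -
    obtain g C m where d: "d = cut g C" "g \<in> S" "C \<in> atoms_of (F m)"
      using dict by (auto simp: dict_def atoms_def)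
    have "P d n" if n: "n \<ge> m" for n
      unfolding P_def
    proof
      fix A assume A: "A \<in> atoms_of (F n)"
      from atom_level_dichotomy[OF n d(3) A] show "\<exists>s\<in>S. \<forall>\<omega>\<in>A. d \<omega> = s \<omega>"
      proof
        assume "A \<subseteq> C"
        then show ?thesis
          using d by (intro bexI[of _ g]) (auto simp: cut_def)
      next
        assume "C \<inter> A = {}"
        then show ?thesis
          using d scalar_fun.subspace_0[OF S] by (intro bexI[of _ 0]) (auto simp: cut_def indicator_def)
      qed
    qed
    then show ?thesis
      by (rule eventually_sequentiallyI)
  qed
  have "scalar_fun.subspace {h. \<forall>\<^sub>F n in sequentially. P h n}"
    using always_eventually[OF allI[OF P_zero]]
    by (intro scalar_fun.subspaceI) (auto elim: eventually_elim2 eventually_mono intro: P_add P_scale)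
  then have "scalar_fun.span (dict F S) \<subseteq> {h. \<forall>\<^sub>F n in sequentially. P h n}"
    using P_dict by (intro scalar_fun.span_minimal) auto
  then show ?thesis
    using h by (auto simp: P_def)
qed

lemma LpS_measurable: "LpS M F S p \<subseteq> borel_measurable M"
  by (auto simp: LpS_def Lp_space_def)

text \<open>With \<open>\<epsilon> = t 2\<^bsup>- n / \<sigma>\<^esup>\<close> a packing by bad sets has at most \<open>2\<^sup>n\<close> members, so a constant times
  \<open>2\<^sup>n\<close> pieces suffice, and the \<open>p\<close>-th power of the error is at most a constant times
  \<open>2\<^sup>n \<epsilon>\<^sup>p = t\<^sup>p 2\<^bsup>- n \<beta> p\<^esup>\<close> with \<open>\<beta> = 1/\<sigma> - 1/p\<close>.\<close>

lemma jackson_threshold: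
  fixes S :: "('a \<Rightarrow> 'k::{real_normed_field,euclidean_space}) set"
  assumes S: "scalar_fun.subspace S" "S \<subseteq> borel_measurable M" and exponents: "0 < \<sigma>" "\<sigma> < p"
    and f: "f \<in> LpS M F S p" and var: "variation M F S \<sigma> p f \<le> ennreal t" "0 < t"
    and c: "2 * (2 * \<nu> + 1) \<le> 2 ^ c"
  shows "n_term_error (Lp_norm M p) (dict F S) (2 ^ (c + n)) f
    \<le> ennreal ((2 * real \<nu> + 1) powr (1 / p) * 2 powr (- real n * (1 / \<sigma> - 1 / p)) * t)"
proof -
  define \<epsilon> where "\<epsilon> = t * 2 powr (- real n / \<sigma>)"
  have \<epsilon>: "\<epsilon> > 0"
    using var by (simp add: \<epsilon>_def)
  have [measurable]: "f \<in> borel_measurable M"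
    using f LpS_measurable by auto
  interpret threshold_approximation M \<nu> F S p \<epsilon> f
    using S exponents \<epsilon> by unfold_locales auto
  obtain h where h: "h \<in> scalar_fun.span (dict F S)" "Lp_norm M p (f - h) < ennreal \<epsilon>"
    using f \<epsilon> by (auto simp: LpS_def)
  obtain N where N: "\<And>A. A \<in> atoms_of (F N) \<Longrightarrow> \<exists>s\<in>S. \<forall>\<omega>\<in>A. h \<omega> = s \<omega>"
    using eventually_happens'[OF sequentially_bot span_dict_locally_in_S[OF S(1) h(1)]] by blast
  have "good A" if A: "A \<in> atoms_of (F N)" for A
  proof -
    obtain s where s: "s \<in> S" "\<forall>\<omega>\<in>A. h \<omega> = s \<omega>"
      using N[OF A] by auto
    have "Lp_norm_on M p A (f - s) = Lp_norm_on M p A (f - h)"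
      using s by (intro Lp_norm_on_cong) simp
    also have "\<dots> \<le> Lp_norm M p (f - h)"
    proof (rule Lp_norm_on_mono_set)
      have "A \<in> sets M"
        using A atoms_sets by (auto simp: atoms_def)
      then show "A \<subseteq> space M"
        by (rule sets.sets_into_space)
    qed (use exponents in simp)
    finally show ?thesis
      using h(2) s(1) unfolding good_def by (intro bexI[of _ s]) auto
  qed
  then obtain k where k: "packing (space M) k" "approximable (space M) (1 + 2 * \<nu> * k)"
    by (rule approximable_space)
  have "\<epsilon> powr \<sigma> = t powr \<sigma> / 2 ^ n"
    using exponents var by (simp add: \<epsilon>_def powr_mult powr_powr powr_minus_divide powr_divide powr_realpow)
  then have "real k * (t powr \<sigma> / 2 ^ n) \<le> t powr \<sigma>"
    using packing_card_le[OF k(1) exponents(1) var(1)] var(2) by simp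
  then have "real k * t powr \<sigma> \<le> 2 ^ n * t powr \<sigma>"
    by (simp add: divide_le_eq mult.commute)
  then have "real k \<le> 2 ^ n"
    using var(2) by simp
  then have k_le: "k \<le> 2 ^ n"
    by (metis of_nat_le_iff of_nat_numeral of_nat_power)
  define m where "m = 1 + 2 * \<nu> * k"
  have "m \<le> 1 * 2 ^ n + 2 * \<nu> * 2 ^ n"
    unfolding m_def using k_le by (intro add_mono mult_le_mono2) auto
  then have m_le: "m \<le> (2 * \<nu> + 1) * 2 ^ n"
    by (simp add: algebra_simps)
  have "2 * m \<le> (2 * (2 * \<nu> + 1)) * 2 ^ n"
    using m_le by simp
  also have "\<dots> \<le> 2 ^ c * 2 ^ n"
    using c by (rule mult_le_mono1)
  finally have "2 * m \<le> 2 ^ (c + n)"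
    by (simp add: power_add)
  then have sub: "n_term (2 * m) (dict F S) \<subseteq> n_term (2 ^ (c + n)) (dict F S)"
    by (intro n_term_mono zero_dict)
  obtain y where y: "y \<in> n_term (2 * m) (dict F S)"
    "(\<integral>\<^sup>+\<omega>\<in>space M. ennreal (norm ((f - y) \<omega>) powr p) \<partial>M) \<le> of_nat m * ennreal (\<epsilon> powr p)"
    using k(2) unfolding approximable_def m_def by blast
  let ?X = "(2 * real \<nu> + 1) powr (1 / p) * 2 powr (- real n * (1 / \<sigma> - 1 / p)) * t"
  have "of_nat m * ennreal (\<epsilon> powr p) \<le> of_nat ((2 * \<nu> + 1) * 2 ^ n) * ennreal (\<epsilon> powr p)"
    by (intro mult_right_mono of_nat_mono m_le) simp
  also have "\<dots> = ennreal (real ((2 * \<nu> + 1) * 2 ^ n) * \<epsilon> powr p)"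
    by (simp only: ennreal_of_nat_eq_real_of_nat ennreal_mult' of_nat_0_le_iff)
  also have "real ((2 * \<nu> + 1) * 2 ^ n) * \<epsilon> powr p = ?X powr p"
  proof -
    have "?X powr p = (2 * real \<nu> + 1) * 2 powr (- real n * (1 / \<sigma> - 1 / p) * p) * t powr p"
      using exponents var by (simp add: powr_mult powr_powr)
    also have "- real n * (1 / \<sigma> - 1 / p) * p = real n + (- real n / \<sigma>) * p"
      using exponents by (simp add: field_simps)
    also have "2 powr (real n + (- real n / \<sigma>) * p) = 2 ^ n * (2 powr (- real n / \<sigma>)) powr p"
      by (simp only: powr_add powr_powr) (simp add: powr_realpow)
    finally show ?thesis
      using var by (simp add: \<epsilon>_def powr_mult distrib_right)
  qed
  also have "ennreal (?X powr p) = ennpowr (ennreal ?X) p"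
    using var by (simp add: ennpowr_ennreal)
  finally have "Lp_norm M p (f - y) \<le> ennreal ?X"
    using y(2) exponents by (simp add: Lp_norm_on_le_iff)
  then show ?thesis
    unfolding n_term_error_def using y(1) sub by (intro INF_lower2[of y]) auto
qed

text \<open>The numbers of terms below \<open>2\<^sup>c\<close> are covered by the trivial approximation by \<open>0\<close>, at the price of a
  larger constant. If the norm is \<open>0\<close>, there is no positive threshold proportional to it, and the trivial
  approximation is already exact.\<close>

lemma jackson_V_norm:
  fixes S :: "('a \<Rightarrow> 'k::{real_normed_field,euclidean_space}) set"
  assumes S: "scalar_fun.subspace S" "S \<subseteq> borel_measurable M" and exponents: "0 < \<sigma>" "\<sigma> < p"
    and \<beta>: "\<beta> = 1 / \<sigma> - 1 / p"
    and f: "f \<in> LpS M F S p" "V_norm M F S \<sigma> p f < \<infinity>"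
    and c: "2 * (2 * \<nu> + 1) \<le> 2 ^ c"
  shows "n_term_error (Lp_norm M p) (dict F S) (2 ^ n) f
    \<le> ennreal ((2 * real \<nu> + 1) powr (1 / p) * 2 powr (real c * \<beta>) * 2 powr (- real n * \<beta>)) * V_norm M F S \<sigma> p f"
    (is "?e \<le> ennreal ?J * ?V")
proof -
  have "\<beta> > 0"
    using exponents by (simp add: \<beta> frac_less2)
  have "0 \<in> n_term (2 ^ n) (dict F S)"
    using zero_in_dict[OF S(1)] space_atom by (intro zero_in_n_term) (auto simp: atoms_def)
  then have "?e \<le> Lp_norm M p (f - 0)"
    unfolding n_term_error_def by (rule INF_lower)
  then have trivial: "?e \<le> ?V"
    unfolding V_norm_def by (auto intro: order_trans)
  show ?thesis
  proof (cases "?V = 0 \<or> n < c")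
    case True
    then show ?thesis
    proof
      assume "?V = 0"
      then show ?thesis
        using trivial by simp
    next
      assume "n < c"
      have "1 * 1 \<le> (2 * real \<nu> + 1) powr (1 / p) * 2 powr ((real c - real n) * \<beta>)"
        using \<open>n < c\<close> \<open>\<beta> > 0\<close> exponents by (intro mult_mono ge_one_powr_ge_zero) auto
      also have "\<dots> = ?J"
        by (simp add: powr_add[symmetric] left_diff_distrib mult.assoc)
      finally have "1 * ?V \<le> ennreal ?J * ?V"
        by (intro mult_right_mono) (auto simp flip: ennreal_1 intro: ennreal_leI)
      then show ?thesis
        using trivial by simp
    qed
  next
    case False
    obtain t where t: "?V = ennreal t" "0 \<le> t"
      using f(2) by (cases "?V") auto
    then have "t > 0"
      using False by (auto simp: less_le)
    have "variation M F S \<sigma> p f \<le> ennreal t"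
      unfolding t(1)[symmetric] V_norm_def by simp
    then have "n_term_error (Lp_norm M p) (dict F S) (2 ^ (c + (n - c))) f
        \<le> ennreal ((2 * real \<nu> + 1) powr (1 / p) * 2 powr (- real (n - c) * (1 / \<sigma> - 1 / p)) * t)"
      using S exponents f(1) \<open>t > 0\<close> c by (intro jackson_threshold)
    also have "(2 * real \<nu> + 1) powr (1 / p) * 2 powr (- real (n - c) * (1 / \<sigma> - 1 / p)) = ?J"
      using False by (simp add: powr_add[symmetric] of_nat_diff algebra_simps flip: \<beta>)
    finally show ?thesis
      using False t by (simp add: ennreal_mult)
  qed
qed

end

section \<open>The interpolation theorem\<close>

lemma V_norm_triangle:
  assumes "p > 0" "\<sigma> > 0" "atoms F \<union> rings F \<subseteq> sets M" "scalar_fun.subspace S" "S \<subseteq> borel_measurable M"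
    and "f \<in> borel_measurable M" "g \<in> borel_measurable M"
  shows "V_norm M F S \<sigma> p (f + g) \<le> ennreal (Lp_quasi_constant p * Lp_quasi_constant \<sigma>) *
      (V_norm M F S \<sigma> p f + V_norm M F S \<sigma> p g)"
proof -
  let ?C = "ennreal (Lp_quasi_constant p * Lp_quasi_constant \<sigma>)"
  have "Lp_quasi_constant p * 1 \<le> Lp_quasi_constant p * Lp_quasi_constant \<sigma>"
    using Lp_quasi_constant_ge_1[OF assms(1)] Lp_quasi_constant_ge_1[OF assms(2)] by (intro mult_left_mono) auto
  then have "ennreal (Lp_quasi_constant p) \<le> ?C"
    by (intro ennreal_leI) simp
  then have "Lp_norm M p (f + g) \<le> ?C * (Lp_norm M p f + Lp_norm M p g)"
    using Lp_norm_on_triangle[OF assms(1) sets.top assms(6,7)] by (meson mult_right_mono order_trans zero_le)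
  moreover have "variation M F S \<sigma> p (f + g) \<le> ?C * (variation M F S \<sigma> p f + variation M F S \<sigma> p g)"
    using assms by (rule variation_triangle)
  ultimately have "V_norm M F S \<sigma> p (f + g) \<le> ?C * (Lp_norm M p f + Lp_norm M p g)
      + ?C * (variation M F S \<sigma> p f + variation M F S \<sigma> p g)"
    unfolding V_norm_def by (rule add_mono)
  then show ?thesis
    by (simp add: V_norm_def distrib_left ac_simps)
qed

context atomic_filtration
begin

lemma bounded_mem_Lp_space:
  fixes f :: "'a \<Rightarrow> 'k::{real_normed_field,euclidean_space}"
  assumes "p > 0" "f \<in> borel_measurable M" "\<And>\<omega>. \<omega> \<in> space M \<Longrightarrow> norm (f \<omega>) \<le> b"
  shows "f \<in> Lp_space M p"
proof -
  have "(\<integral>\<^sup>+\<omega>\<in>space M. ennreal (norm (f \<omega>) powr p) \<partial>M) \<le> (\<integral>\<^sup>+\<omega>. ennreal (b powr p) \<partial>M)"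
    using assms(1,3) by (intro nn_integral_mono) (auto intro!: ennreal_leI powr_mono2)
  also have "\<dots> < top"
    by (simp add: emeasure_space_1)
  finally have "Lp_norm M p f \<noteq> top"
    by (simp add: Lp_norm_on_def)
  then show ?thesis
    using assms(2) by (simp add: Lp_space_def less_top)
qed

lemma span_dict_subset_LpS:
  fixes S :: "('a \<Rightarrow> 'k::{real_normed_field,euclidean_space}) set"
  assumes "p > 0" and S: "\<And>f. f \<in> S \<Longrightarrow> f \<in> borel_measurable M"
    and bounded: "\<And>f. f \<in> S \<Longrightarrow> \<exists>b. \<forall>\<omega>\<in>space M. norm (f \<omega>) \<le> b"
  shows "scalar_fun.span (dict F S) \<subseteq> LpS M F S p"
proof
  let ?B = "{h :: 'a \<Rightarrow> 'k. h \<in> borel_measurable M \<and> (\<exists>b. \<forall>\<omega>\<in>space M. norm (h \<omega>) \<le> b)}"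
  fix h assume h: "h \<in> scalar_fun.span (dict F S)"
  have "dict F S \<subseteq> ?B"
  proof
    fix d assume "d \<in> dict F S"
    then obtain g A where d: "d = cut g A" "g \<in> S" "A \<in> atoms F"
      by (auto simp: dict_def)
    have [measurable]: "A \<in> sets M" "g \<in> borel_measurable M"
      using d atoms_sets S by auto
    obtain b where "\<forall>\<omega>\<in>space M. norm (g \<omega>) \<le> b"
      using bounded d by blast
    then have "\<forall>\<omega>\<in>space M. norm (d \<omega>) \<le> max b 0"
      by (auto simp: d cut_def indicator_def)
    then show "d \<in> ?B"
      unfolding d(1) cut_def by auto
  qed
  moreover have "scalar_fun.subspace ?B"
  proof (rule scalar_fun.subspaceI)
    show "0 \<in> ?B"
      by (auto simp: zero_fun_def)
  next
    fix g h assume "g \<in> ?B" "h \<in> ?B"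
    then obtain a b where ab: "\<forall>\<omega>\<in>space M. norm (g \<omega>) \<le> a" "\<forall>\<omega>\<in>space M. norm (h \<omega>) \<le> b"
      and [measurable]: "g \<in> borel_measurable M" "h \<in> borel_measurable M"
      by auto
    have "\<forall>\<omega>\<in>space M. norm ((g + h) \<omega>) \<le> a + b"
      using ab by (auto intro: norm_triangle_mono)
    then show "g + h \<in> ?B"
      by (auto simp: plus_fun_def)
  next
    fix c h assume "h \<in> ?B"
    then obtain b where b: "\<forall>\<omega>\<in>space M. norm (h \<omega>) \<le> b" and [measurable]: "h \<in> borel_measurable M"
      by auto
    have "\<forall>\<omega>\<in>space M. norm (fscale c h \<omega>) \<le> norm c * b"
      using b by (auto simp: fscale_def norm_mult intro: mult_left_mono)
    moreover have "fscale c h \<in> borel_measurable M"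
      by (simp add: fscale_def)
    ultimately show "fscale c h \<in> ?B"
      by auto
  qed
  ultimately have "scalar_fun.span (dict F S) \<subseteq> ?B"
    by (rule scalar_fun.span_minimal)
  then have "h \<in> ?B"
    using h by blast
  then have "h \<in> Lp_space M p"
    using bounded_mem_Lp_space[OF assms(1)] by blast
  moreover have "Lp_norm M p (h - h) < ennreal \<epsilon>" if "\<epsilon> > 0" for \<epsilon>
    using that by simp
  ultimately show "h \<in> LpS M F S p"
    using h unfolding LpS_def by (intro CollectI conjI allI impI bexI[of _ h])
qed

lemma n_term_subset_span: "n_term n D \<subseteq> scalar_fun.span D"
  unfolding n_term_def
  by (auto intro!: scalar_fun.span_sum scalar_fun.span_scale intro: scalar_fun.span_base)

lemma LpS_diff:
  fixes f g :: "'a \<Rightarrow> 'k::{real_normed_field,euclidean_space}"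
  assumes "p > 0" and f: "f \<in> LpS M F S p" and g: "g \<in> LpS M F S p"
    and span: "scalar_fun.span (dict F S) \<subseteq> LpS M F S p"
  shows "f - g \<in> LpS M F S p"
proof -
  let ?Q = "Lp_quasi_constant p"
  have Q: "?Q > 0"
    using Lp_quasi_constant_ge_1[OF assms(1)] by simp
  have [measurable]: "f \<in> borel_measurable M" "g \<in> borel_measurable M"
    using f g LpS_measurable by auto
  have "Lp_norm M p (f + (0 - g)) \<le> ennreal ?Q * (Lp_norm M p f + Lp_norm M p (0 - g))"
    using assms(1) by (intro Lp_norm_on_triangle) (auto simp: fun_diff_def)
  also have "Lp_norm M p (0 - g) = Lp_norm M p g"
    by (intro Lp_norm_on_cong) simp
  also have "ennreal ?Q * (Lp_norm M p f + Lp_norm M p g) < top"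
    using f g by (auto simp: LpS_def Lp_space_def ennreal_mult_less_top)
  finally have finite: "Lp_norm M p (f - g) < top"
    by (simp add: fun_diff_def)
  have "\<exists>h\<in>scalar_fun.span (dict F S). Lp_norm M p ((f - g) - h) < ennreal \<epsilon>" if "\<epsilon> > 0" for \<epsilon>
  proof -
    have \<delta>: "\<epsilon> / (2 * ?Q) > 0"
      using that Q by simp
    obtain u where u: "u \<in> scalar_fun.span (dict F S)" "Lp_norm M p (f - u) < ennreal (\<epsilon> / (2 * ?Q))"
      using f \<delta> by (auto simp: LpS_def)
    obtain v where v: "v \<in> scalar_fun.span (dict F S)" "Lp_norm M p (g - v) < ennreal (\<epsilon> / (2 * ?Q))"
      using g \<delta> by (auto simp: LpS_def)
    have [measurable]: "u \<in> borel_measurable M" "v \<in> borel_measurable M"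
      using u v span LpS_measurable by blast+
    have "(f - g) - (u - v) = (f - u) + (v - g)"
      by (simp add: algebra_simps)
    then have "Lp_norm M p ((f - g) - (u - v)) \<le> ennreal ?Q * (Lp_norm M p (f - u) + Lp_norm M p (v - g))"
      using Lp_norm_on_triangle[OF assms(1) sets.top, of "f - u" M "v - g"] by (simp add: fun_diff_def)
    also have "Lp_norm M p (v - g) = Lp_norm M p (g - v)"
      by (rule Lp_norm_on_minus_commute)
    also have "ennreal ?Q * (Lp_norm M p (f - u) + Lp_norm M p (g - v))
        < ennreal ?Q * (ennreal (\<epsilon> / (2 * ?Q)) + ennreal (\<epsilon> / (2 * ?Q)))"
      using u(2) v(2) Q by (intro ennreal_mult_strict_left_mono add_strict_mono) auto
    also have "\<dots> = ennreal \<epsilon>"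
      using that Q by (simp flip: ennreal_plus ennreal_mult)
    finally show ?thesis
      using scalar_fun.span_diff[OF u(1) v(1)] by blast
  qed
  then show ?thesis
    using finite by (auto simp: LpS_def Lp_space_def fun_diff_def)
qed

lemma jackson_bernstein_LpS_V:
  fixes S :: "('a \<Rightarrow> 'k::{real_normed_field,euclidean_space}) set"
  assumes subspace: "scalar_fun.subspace S" and meas: "\<And>f. f \<in> S \<Longrightarrow> f \<in> borel_measurable M"
    and bounded: "\<And>f. f \<in> S \<Longrightarrow> \<exists>b. \<forall>\<omega>\<in>space M. norm (f \<omega>) \<le> b"
    and exponents: "0 < \<sigma>" "\<sigma> < p" and \<beta>: "\<beta> = 1 / \<sigma> - 1 / p"
  obtains Q J B where
    "jackson_bernstein_pair (LpS M F S p) (Lp_norm M p) (V_norm M F S \<sigma> p) (dict F S) \<beta> Q J B"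
proof -
  have p: "p > 0"
    using exponents by simp
  have S_meas: "S \<subseteq> borel_measurable M"
    using meas by auto
  obtain c where c: "2 * (2 * \<nu> + 1) \<le> 2 ^ c"
    using less_exp[of "2 * (2 * \<nu> + 1)"] less_imp_le by blast
  let ?Q = "Lp_quasi_constant p * Lp_quasi_constant \<sigma>"
  have \<beta>_pos: "\<beta> > 0"
    using exponents by (simp add: \<beta> frac_less2)
  note Q1 = Lp_quasi_constant_ge_1[OF p] Lp_quasi_constant_ge_1[OF exponents(1)]
  have Q_ge: "1 * 1 \<le> ?Q" "Lp_quasi_constant p * 1 \<le> ?Q"
    using mult_mono[OF Q1] mult_left_mono[OF Q1(2), of "Lp_quasi_constant p"] Q1 by auto
  note span = span_dict_subset_LpS[OF p meas bounded]
  have zero_dict: "0 \<in> dict F S"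
    using zero_in_dict[OF subspace] space_atom by (auto simp: atoms_def)
  have n_term: "n_term n (dict F S) \<subseteq> LpS M F S p" for n
    using n_term_subset_span span by blast
  have LpS_meas: "f \<in> borel_measurable M" if "f \<in> LpS M F S p" for f
    using that LpS_measurable by blast
  have "jackson_bernstein_pair (LpS M F S p) (Lp_norm M p) (V_norm M F S \<sigma> p) (dict F S) \<beta> ?Q
     ((2 * real \<nu> + 1) powr (1 / p) * 2 powr (real c * \<beta>)) (1 + 2 powr (1 / \<sigma>))"
  proof
    show "0 \<in> LpS M F S p"
      using span scalar_fun.span_zero by blast
    show "f - g \<in> LpS M F S p" if "f \<in> LpS M F S p" "g \<in> LpS M F S p" for f g
      using p that span by (rule LpS_diff)
    show "Lp_norm M p (f - g) = Lp_norm M p (g - f)" for f g :: "'a \<Rightarrow> 'k"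
      by (rule Lp_norm_on_minus_commute)
    show "Lp_norm M p (f + g) \<le> ennreal ?Q * (Lp_norm M p f + Lp_norm M p g)"
      if "f \<in> LpS M F S p" "g \<in> LpS M F S p" for f g
    proof -
      have "Lp_norm M p (f + g) \<le> ennreal (Lp_quasi_constant p) * (Lp_norm M p f + Lp_norm M p g)"
        using LpS_meas that p by (intro Lp_norm_on_triangle) auto
      also have "\<dots> \<le> ennreal ?Q * (Lp_norm M p f + Lp_norm M p g)"
        using Q_ge(2) by (intro mult_right_mono ennreal_leI) auto
      finally show ?thesis .
    qed
    show "Lp_norm M p f < \<infinity>" if "f \<in> LpS M F S p" for f
      using that by (simp add: LpS_def Lp_space_def)
    show "V_norm M F S \<sigma> p (f + g) \<le> ennreal ?Q * (V_norm M F S \<sigma> p f + V_norm M F S \<sigma> p g)"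
      if "f \<in> LpS M F S p" "g \<in> LpS M F S p" for f g
      using p exponents(1) subspace S_meas LpS_meas[OF that(1)] LpS_meas[OF that(2)] atoms_sets rings_sets
      by (intro V_norm_triangle) auto
    show "n_term_error (Lp_norm M p) (dict F S) (2 ^ n) g
        \<le> ennreal ((2 * real \<nu> + 1) powr (1 / p) * 2 powr (real c * \<beta>) * 2 powr (- real n * \<beta>)) * V_norm M F S \<sigma> p g"
      if "g \<in> LpS M F S p" "V_norm M F S \<sigma> p g < \<infinity>" for g n
      using subspace S_meas exponents \<beta> that c by (rule jackson_V_norm)
    show "V_norm M F S \<sigma> p g \<le> ennreal ((1 + 2 powr (1 / \<sigma>)) * 2 powr (real n * \<beta>)) * Lp_norm M p g"
      if g: "g \<in> n_term (2 ^ n) (dict F S)" for g n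
    proof -
      have "g \<in> borel_measurable M"
        using g n_term LpS_meas by blast
      then have "variation M F S \<sigma> p g
          \<le> ennreal (2 powr (1 / \<sigma>) * real (2 ^ n) powr (1 / \<sigma> - 1 / p)) * Lp_norm M p g"
        using subspace exponents g by (intro bernstein_variation) auto
      also have "real (2 ^ n) powr (1 / \<sigma> - 1 / p) = 2 powr (real n * \<beta>)"
        by (simp add: \<beta> powr_powr flip: powr_realpow)
      finally have "V_norm M F S \<sigma> p g
          \<le> ennreal 1 * Lp_norm M p g + ennreal (2 powr (1 / \<sigma>) * 2 powr (real n * \<beta>)) * Lp_norm M p g"
        unfolding V_norm_def by (intro add_mono) auto
      also have "\<dots> \<le> ennreal (2 powr (real n * \<beta>)) * Lp_norm M p g
          + ennreal (2 powr (1 / \<sigma>) * 2 powr (real n * \<beta>)) * Lp_norm M p g"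
        using \<beta>_pos by (intro add_right_mono mult_right_mono ennreal_leI ge_one_powr_ge_zero) auto
      also have "\<dots> = ennreal ((1 + 2 powr (1 / \<sigma>)) * 2 powr (real n * \<beta>)) * Lp_norm M p g"
        by (simp add: distrib_right)
      finally show ?thesis .
    qed
    have "1 * 1 \<le> (2 * real \<nu> + 1) powr (1 / p) * 2 powr (real c * \<beta>)"
      using \<beta>_pos p by (intro mult_mono ge_one_powr_ge_zero) auto
    then show "1 \<le> (2 * real \<nu> + 1) powr (1 / p) * 2 powr (real c * \<beta>)"
      by simp
  qed (use Q_ge zero_dict n_term \<beta>_pos in \<open>auto simp: V_norm_def\<close>)
  then show thesis
    by (rule that)
qed

end

theorem theorem3p2:
  fixes M :: "'a measure"
    and \<nu> :: nat
    and F :: "nat \<Rightarrow> 'a set set"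
    and S :: "('a \<Rightarrow> 'k::{real_normed_field,euclidean_space}) set"
    and \<sigma> p \<alpha> \<beta> :: real
    and q :: ennreal
  assumes "prob_space M"
    and "\<nu> \<ge> 2"
    and "nary_filtration M \<nu> F"
    and "admissible_space M F S"
    and "0 < \<sigma>" and "\<sigma> < p"
    and "\<beta> = 1 / \<sigma> - 1 / p"
    and "0 < \<alpha>" and "\<alpha> < \<beta>"
    and "0 < q"
  shows "approx_space (LpS M F S p) (Lp_norm M p) (dict F S) \<alpha> q
           = interp_space (LpS M F S p) (Lp_norm M p) (V_space M F S \<sigma> p) (V_norm M F S \<sigma> p) (\<alpha> / \<beta>) q
       \<and> equivalent_on (approx_space (LpS M F S p) (Lp_norm M p) (dict F S) \<alpha> q)
           (approx_norm (Lp_norm M p) (dict F S) \<alpha> q)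
           (interp_norm (Lp_norm M p) (V_space M F S \<sigma> p) (V_norm M F S \<sigma> p) (\<alpha> / \<beta>) q)"
proof -
  interpret atomic_filtration M \<nu> F
    using assms(1,3) by (simp add: atomic_filtration_def atomic_filtration_axioms_def)
  have "scalar_fun.subspace S"
    using assms(4) by (auto simp: admissible_space_def scalar_fun.subspace_span)
  moreover have "f \<in> borel_measurable M" "\<exists>b. \<forall>\<omega>\<in>space M. norm (f \<omega>) \<le> b" if "f \<in> S" for f
    using assms(4) that by (auto simp: admissible_space_def)
  ultimately obtain Q J B where
    "jackson_bernstein_pair (LpS M F S p) (Lp_norm M p) (V_norm M F S \<sigma> p) (dict F S) \<beta> Q J B"
    using jackson_bernstein_LpS_V[of S \<sigma> p \<beta>] assms(5-7) by blast
  then interpret jackson_bernstein_pair "LpS M F S p" "Lp_norm M p" "V_norm M F S \<sigma> p" "dict F S" \<beta> Q J B .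
  have "Y = V_space M F S \<sigma> p"
    by (simp add: Y_def V_space_def)
  then show ?thesis
    using approx_space_eq_interp_space[OF assms(10,8,9)] by simp
qed

end
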